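(* Let $k$ be a commutative ring and let $(A,\rho,T,T)$ be a balanced oriented quantum algebra over $k$. Let $\mathrm{Rep}:A\to M_n(k)$ be a representation of $A$ to the ring of $n\times n$ matrices over $k$. Suppose there is an invertible matrix $M\in M_n(k)$ such that the automorphism $\tau:M_n(k)\to M_n(k)$, $\tau(x)=MxM^{-1}$, gives $\mathrm{Rep}(A)$ the structure of a balanced oriented quantum algebra such that $\mathrm{Rep}(T(a))=\tau(\mathrm{Rep}(a))$ for all $a\in A$. Then the matrices $\mathrm{Rep}(\rho)$, $\mathrm{Rep}(\rho^{-1})$ and $M$ give data for a matrix model oriented link invariant of regular isotopy; that is, the evaluation $Z(K)\in k$ of the matrix model built from these matrices (defined in the context) takes equal values on any two regularly isotopic oriented knot or link diagrams $K$ in Morse position.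
   Context: **Balanced oriented quantum algebra.** $(A,\rho,T,T)$ where $A$ is an associative unital $k$-algebra, $\rho=\sum e\otimes e'\in A\otimes A$ is invertible with inverse $\rho^{-1}=\sum E\otimes E'$ and satisfies $\rho_{12}\rho_{13}\rho_{23}=\rho_{23}\rho_{13}\rho_{12}$ in $A^{\otimes3}$, and $T$ is an algebra automorphism of $A$ with $(T\otimes T)\rho=\rho$ and such that $(1_A\otimes T)\rho$ and $(T\otimes 1_{A^{op}})\rho^{-1}$ are mutually inverse (two-sided) in $A\otimes A^{op}$. The structure on $\mathrm{Rep}(A)$ is given by the images $(\mathrm{Rep}\otimes\mathrm{Rep})(\rho^{\pm1})$, also written $\mathrm{Rep}(\rho^{\pm1})$, and by $\tau$. **Diagrams.** Oriented knot and link diagrams are drawn in Morse position with respect to a vertical direction, i.e. as compositions of caps (local maxima), cups (local minima) and crossings at distinct heights. Regular isotopy is generated by planar isotopies (including cancellation of adjacent maximum/minimum pairs and switchback moves passing a strand across a maximum or minimum), and by Reidemeister moves II and III with all orientations (not Reidemeister I). **Matrix model.** For a matrix $x$ write $x_i^j=x_{ij}$ (row $i$, column $j$). Mark one point on each arc of the diagram between consecutive critical points (caps, cups, crossings). A coloring assigns to each marked point an index in $\{1,\dots,n\}$. $Z(K)$ is the sum over all colorings of the product of the following entries, one for each cap, cup and crossing. * Cap with left leg colored $a$ and right leg colored $b$: $\overline{M}^{>}_{ab}=M_{ab}$ if oriented clockwise, $\overline{M}^{<}_{ab}=(M^{-1})_{ba}$ if oriented counterclockwise. * Cup with left leg colored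 $a$ and right leg colored $b$: $\underline{M}_{>}^{ab}=(M^{-1})_{ab}$ if oriented counterclockwise, $\underline{M}_{<}^{ab}=M_{ba}$ if oriented clockwise. * Crossings, with upper left, upper right, lower left, lower right colors $a,b,c,d$ and denoted $X^{ab}_{cd}$. Both strands up: the positive crossing (the overcrossing strand goes from lower left to upper right) has $\overline{R}^{ab}_{cd}=\sum \mathrm{Rep}(e)_c^b\,\mathrm{Rep}(e')_d^a$, and the negative crossing has $\overline{S}^{ab}_{cd}=\sum \mathrm{Rep}(E)_d^a\,\mathrm{Rep}(E')_c^b$. Both strands down: positive $\underline{R}^{ab}_{cd}=\overline{R}^{dc}_{ba}$, negative $\underline{S}^{ab}_{cd}=\overline{S}^{dc}_{ba}$. Both strands pointing left: positive $|R^{ab}_{cd}=\sum_{i,j}\overline{M}^{<}_{ci}\overline{R}^{ia}_{dj}\underline{M}_{<}^{jb}$, negative $|S^{ab}_{cd}=\sum_{i,j}\overline{M}^{<}_{ci}\overline{S}^{ia}_{dj}\underline{M}_{<}^{jb}$. Both strands pointing right: positive $R|^{ab}_{cd}=\sum_{i,j}\overline{M}^{>}_{ci}\underline{R}^{ia}_{dj}\underline{M}_{>}^{jb}$, negative $S|^{ab}_{cd}=\sum_{i,j}\overline{M}^{>}_{ci}\underline{S}^{ia}_{dj}\underline{M}_{>}^{jb}$. *)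

theory Defs
  imports "HOL-Analysis.Analysis" "HOL-Algebra.Module" "HOL-Algebra.QuotRing"
begin

section \<open>Associative unital algebras\<close>

definition scalars :: "'k::comm_ring_1 ring" where
  "scalars = \<lparr>carrier = UNIV, mult = (*), one = 1, zero = 0, add = (+)\<rparr>"

(* The locale algebra of HOL-Algebra demands a commutative ring, so it does not fit here. *)
definition k_algebra :: "('k::comm_ring_1, 'a, 'm) module_scheme \<Rightarrow> bool" where
  "k_algebra A \<longleftrightarrow> ring A \<and> Module.module scalars A \<and>
     (\<forall>r. \<forall>x\<in>carrier A. \<forall>y\<in>carrier A.
        r \<odot>\<^bsub>A\<^esub> (x \<otimes>\<^bsub>A\<^esub> y) = (r \<odot>\<^bsub>A\<^esub> x) \<otimes>\<^bsub>A\<^esub> y \<and>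
        r \<odot>\<^bsub>A\<^esub> (x \<otimes>\<^bsub>A\<^esub> y) = x \<otimes>\<^bsub>A\<^esub> (r \<odot>\<^bsub>A\<^esub> y))"

definition algebra_hom ::
  "('k::comm_ring_1, 'a, 'm) module_scheme \<Rightarrow> ('k, 'b, 'l) module_scheme \<Rightarrow> ('a \<Rightarrow> 'b) \<Rightarrow> bool" where
  "algebra_hom A B f \<longleftrightarrow> f \<in> ring_hom A B \<and>
     (\<forall>r. \<forall>x\<in>carrier A. f (r \<odot>\<^bsub>A\<^esub> x) = r \<odot>\<^bsub>B\<^esub> f x)"

definition algebra_automorphism ::
  "('k::comm_ring_1, 'a, 'm) module_scheme \<Rightarrow> ('a \<Rightarrow> 'a) \<Rightarrow> bool" where
  "algebra_automorphism A f \<longleftrightarrow> algebra_hom A A f \<and> bij_betw f (carrier A) (carrier A)"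

definition matrix_algebra :: "('k::comm_ring_1, 'k^'n^'n) module" where
  "matrix_algebra = \<lparr>carrier = UNIV, mult = (**), one = mat 1, zero = 0, add = (+),
     smult = (\<lambda>r x. \<chi> i j. r * x $ i $ j)\<rparr>"

section \<open>Tensor products\<close>

(* An element of A \<otimes> A (or A \<otimes> A \<otimes> A) is represented by a finite list of pairs (triples), read
   as the sum of the corresponding simple tensors.  Equality in the tensor product over k is the
   least congruence on such formal sums containing the (multi)linearity relations.  No formal
   negatives are needed, because - (x \<otimes> y) = (- x) \<otimes> y; the rules "zero" make the quotient a group.
   All relations are between tensors of elements of the carrier: for a subalgebra B of A, the
   map B \<otimes> B \<rightarrow> A \<otimes> A need not be injective. *)

inductive sum_congruence :: "('s list \<Rightarrow> 's list \<Rightarrow> bool) \<Rightarrow> 's list \<Rightarrow> 's list \<Rightarrow> bool"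
  for G where
  cong_base: "G X Y \<Longrightarrow> sum_congruence G X Y"
| cong_refl: "sum_congruence G X X"
| cong_sym: "sum_congruence G X Y \<Longrightarrow> sum_congruence G Y X"
| cong_trans: "sum_congruence G X Y \<Longrightarrow> sum_congruence G Y Z \<Longrightarrow> sum_congruence G X Z"
| cong_append: "sum_congruence G X Y \<Longrightarrow> sum_congruence G X' Y' \<Longrightarrow> sum_congruence G (X @ X') (Y @ Y')"
| cong_comm: "sum_congruence G (X @ Y) (Y @ X)"

inductive tensor2_rel ::
  "('k::comm_ring_1, 'a, 'm) module_scheme \<Rightarrow> ('a \<times> 'a) list \<Rightarrow> ('a \<times> 'a) list \<Rightarrow> bool"
  for A (structure) where
  add1: "\<lbrakk>x \<in> carrier A; x' \<in> carrier A; y \<in> carrier A\<rbrakk>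
           \<Longrightarrow> tensor2_rel A [(x \<oplus> x', y)] [(x, y), (x', y)]"
| add2: "\<lbrakk>x \<in> carrier A; y \<in> carrier A; y' \<in> carrier A\<rbrakk>
           \<Longrightarrow> tensor2_rel A [(x, y \<oplus> y')] [(x, y), (x, y')]"
| smult: "\<lbrakk>x \<in> carrier A; y \<in> carrier A\<rbrakk> \<Longrightarrow> tensor2_rel A [(r \<odot> x, y)] [(x, r \<odot> y)]"
| zero1: "y \<in> carrier A \<Longrightarrow> tensor2_rel A [(\<zero>, y)] []"
| zero2: "x \<in> carrier A \<Longrightarrow> tensor2_rel A [(x, \<zero>)] []"

inductive tensor3_rel ::
  "('k::comm_ring_1, 'a, 'm) module_scheme \<Rightarrow> ('a \<times> 'a \<times> 'a) list \<Rightarrow> ('a \<times> 'a \<times> 'a) list \<Rightarrow> bool"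
  for A (structure) where
  add1: "\<lbrakk>x \<in> carrier A; x' \<in> carrier A; y \<in> carrier A; z \<in> carrier A\<rbrakk>
           \<Longrightarrow> tensor3_rel A [(x \<oplus> x', y, z)] [(x, y, z), (x', y, z)]"
| add2: "\<lbrakk>x \<in> carrier A; y \<in> carrier A; y' \<in> carrier A; z \<in> carrier A\<rbrakk>
           \<Longrightarrow> tensor3_rel A [(x, y \<oplus> y', z)] [(x, y, z), (x, y', z)]"
| add3: "\<lbrakk>x \<in> carrier A; y \<in> carrier A; z \<in> carrier A; z' \<in> carrier A\<rbrakk>
           \<Longrightarrow> tensor3_rel A [(x, y, z \<oplus> z')] [(x, y, z), (x, y, z')]"
| smult12: "\<lbrakk>x \<in> carrier A; y \<in> carrier A; z \<in> carrier A\<rbrakk>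
           \<Longrightarrow> tensor3_rel A [(r \<odot> x, y, z)] [(x, r \<odot> y, z)]"
| smult23: "\<lbrakk>x \<in> carrier A; y \<in> carrier A; z \<in> carrier A\<rbrakk>
           \<Longrightarrow> tensor3_rel A [(x, r \<odot> y, z)] [(x, y, r \<odot> z)]"
| zero1: "\<lbrakk>y \<in> carrier A; z \<in> carrier A\<rbrakk> \<Longrightarrow> tensor3_rel A [(\<zero>, y, z)] []"
| zero2: "\<lbrakk>x \<in> carrier A; z \<in> carrier A\<rbrakk> \<Longrightarrow> tensor3_rel A [(x, \<zero>, z)] []"
| zero3: "\<lbrakk>x \<in> carrier A; y \<in> carrier A\<rbrakk> \<Longrightarrow> tensor3_rel A [(x, y, \<zero>)] []"

definition tensor2_eq ::
  "('k::comm_ring_1, 'a, 'm) module_scheme \<Rightarrow> ('a \<times> 'a) list \<Rightarrow> ('a \<times> 'a) list \<Rightarrow> bool" where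
  "tensor2_eq A = sum_congruence (tensor2_rel A)"

definition tensor3_eq ::
  "('k::comm_ring_1, 'a, 'm) module_scheme \<Rightarrow> ('a \<times> 'a \<times> 'a) list \<Rightarrow> ('a \<times> 'a \<times> 'a) list \<Rightarrow> bool" where
  "tensor3_eq A = sum_congruence (tensor3_rel A)"

(* Products in A \<otimes> A, in A \<otimes> A\<^sup>o\<^sup>p (which has the same underlying module), and in A \<otimes> A \<otimes> A. *)
definition tensor2_mult ::
  "('k::comm_ring_1, 'a, 'm) module_scheme \<Rightarrow> ('a \<times> 'a) list \<Rightarrow> ('a \<times> 'a) list \<Rightarrow> ('a \<times> 'a) list" where
  "tensor2_mult A X Y = [(x \<otimes>\<^bsub>A\<^esub> y, x' \<otimes>\<^bsub>A\<^esub> y'). (x, x') \<leftarrow> X, (y, y') \<leftarrow> Y]"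

definition tensor2_mult_op ::
  "('k::comm_ring_1, 'a, 'm) module_scheme \<Rightarrow> ('a \<times> 'a) list \<Rightarrow> ('a \<times> 'a) list \<Rightarrow> ('a \<times> 'a) list" where
  "tensor2_mult_op A X Y = [(x \<otimes>\<^bsub>A\<^esub> y, y' \<otimes>\<^bsub>A\<^esub> x'). (x, x') \<leftarrow> X, (y, y') \<leftarrow> Y]"

definition tensor3_mult ::
  "('k::comm_ring_1, 'a, 'm) module_scheme \<Rightarrow> ('a \<times> 'a \<times> 'a) list \<Rightarrow> ('a \<times> 'a \<times> 'a) list \<Rightarrow>
     ('a \<times> 'a \<times> 'a) list" where
  "tensor3_mult A X Y =
     [(x \<otimes>\<^bsub>A\<^esub> y, x' \<otimes>\<^bsub>A\<^esub> y', x'' \<otimes>\<^bsub>A\<^esub> y''). (x, x', x'') \<leftarrow> X, (y, y', y'') \<leftarrow> Y]"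

section \<open>Balanced oriented quantum algebras\<close>

definition leg12 :: "('k::comm_ring_1, 'a, 'm) module_scheme \<Rightarrow> ('a \<times> 'a) list \<Rightarrow> ('a \<times> 'a \<times> 'a) list" where
  "leg12 A P = [(e, e', \<one>\<^bsub>A\<^esub>). (e, e') \<leftarrow> P]"

definition leg13 :: "('k::comm_ring_1, 'a, 'm) module_scheme \<Rightarrow> ('a \<times> 'a) list \<Rightarrow> ('a \<times> 'a \<times> 'a) list" where
  "leg13 A P = [(e, \<one>\<^bsub>A\<^esub>, e'). (e, e') \<leftarrow> P]"

definition leg23 :: "('k::comm_ring_1, 'a, 'm) module_scheme \<Rightarrow> ('a \<times> 'a) list \<Rightarrow> ('a \<times> 'a \<times> 'a) list" where
  "leg23 A P = [(\<one>\<^bsub>A\<^esub>, e, e'). (e, e') \<leftarrow> P]"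

(* rho represents the sum of the e \<otimes> e', rho_inv that of the E \<otimes> E'. *)
definition balanced_oriented_quantum_algebra ::
  "('k::comm_ring_1, 'a, 'm) module_scheme \<Rightarrow> ('a \<times> 'a) list \<Rightarrow> ('a \<times> 'a) list \<Rightarrow> ('a \<Rightarrow> 'a) \<Rightarrow> bool" where
  "balanced_oriented_quantum_algebra A rho rho_inv T \<longleftrightarrow>
     k_algebra A \<and>
     set rho \<subseteq> carrier A \<times> carrier A \<and> set rho_inv \<subseteq> carrier A \<times> carrier A \<and>
     tensor2_eq A (tensor2_mult A rho rho_inv) [(\<one>\<^bsub>A\<^esub>, \<one>\<^bsub>A\<^esub>)] \<and>
     tensor2_eq A (tensor2_mult A rho_inv rho) [(\<one>\<^bsub>A\<^esub>, \<one>\<^bsub>A\<^esub>)] \<and>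
     tensor3_eq A
       (tensor3_mult A (tensor3_mult A (leg12 A rho) (leg13 A rho)) (leg23 A rho))
       (tensor3_mult A (tensor3_mult A (leg23 A rho) (leg13 A rho)) (leg12 A rho)) \<and>
     algebra_automorphism A T \<and>
     tensor2_eq A (map (map_prod T T) rho) rho \<and>
     tensor2_eq A (tensor2_mult_op A (map (map_prod id T) rho) (map (map_prod T id) rho_inv))
       [(\<one>\<^bsub>A\<^esub>, \<one>\<^bsub>A\<^esub>)] \<and>
     tensor2_eq A (tensor2_mult_op A (map (map_prod T id) rho_inv) (map (map_prod id T) rho))
       [(\<one>\<^bsub>A\<^esub>, \<one>\<^bsub>A\<^esub>)]"

section \<open>Oriented link diagrams in Morse position\<close>

datatype dir = Up | Down

fun opp :: "dir \<Rightarrow> dir" where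
  "opp Up = Down"
| "opp Down = Up"

(* Cap s, Cup s: s is the direction of the left leg, so Cap Up and Cup Up are clockwise.
   Cross ov s t: s, t are the directions at the lower left and lower right ends; ov holds iff the
   strand joining lower left to upper right is the overcrossing strand. *)
datatype piece = Cap dir | Cup dir | Cross bool dir dir

fun bot :: "piece \<Rightarrow> dir list" where
  "bot (Cap s) = [s, opp s]"
| "bot (Cup s) = []"
| "bot (Cross ov s t) = [s, t]"

fun top :: "piece \<Rightarrow> dir list" where
  "top (Cap s) = []"
| "top (Cup s) = [s, opp s]"
| "top (Cross ov s t) = [t, s]"

(* One critical point, with the directions of the vertical strands to its left and to its right. *)
type_synonym layer = "dir list \<times> piece \<times> dir list"

fun source :: "layer \<Rightarrow> dir list" where
  "source (u, p, v) = u @ bot p @ v"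

fun target :: "layer \<Rightarrow> dir list" where
  "target (u, p, v) = u @ top p @ v"

(* Layers are listed from the bottom to the top of the diagram. *)
definition link_diagram :: "layer list \<Rightarrow> bool" where
  "link_diagram K \<longleftrightarrow> successively (\<lambda>l l'. target l = source l') K \<and>
     (K \<noteq> [] \<longrightarrow> source (hd K) = [] \<and> target (last K) = [])"

(* In each rule the letters s, t, r are the directions of the strands (for a strand with a maximum
   or minimum: of its left leg); they are arbitrary, so all orientations are covered.
   In R3 the flags x, y, z say which strand is on top for each pair of strands; the premise excludes
   the two cyclic (not layered) configurations. *)
inductive local_move :: "layer list \<Rightarrow> layer list \<Rightarrow> bool" where
  heights: "local_move
     [([], p, w @ bot q), (top p @ w, q, [])]
     [(bot p @ w, q, []), ([], p, w @ top q)]"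
| cancel_left: "local_move [([s], Cup (opp s), []), ([], Cap s, [s])] []"
| cancel_right: "local_move [([], Cup s, [s]), ([s], Cap (opp s), [])] []"
| switchback_max: "local_move
     [([], Cross ov s t, [opp s]), ([t], Cap s, [])]
     [([s], Cross (\<not> ov) t (opp s), []), ([], Cap s, [t])]"
| switchback_min: "local_move
     [([t], Cup s, []), ([], Cross ov t s, [opp s])]
     [([], Cup s, [t]), ([s], Cross (\<not> ov) (opp s) t, [])]"
| R2: "local_move [([], Cross ov s t, []), ([], Cross (\<not> ov) t s, [])] []"
| R3: "(x = z \<longrightarrow> y = x) \<Longrightarrow> local_move
     [([], Cross x s t, [r]), ([t], Cross y s r, []), ([], Cross z t r, [s])]
     [([s], Cross z t r, []), ([], Cross y s r, [t]), ([r], Cross x s t, [])]"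

definition whisker :: "dir list \<Rightarrow> dir list \<Rightarrow> layer list \<Rightarrow> layer list" where
  "whisker u v = map (\<lambda>(a, p, b). (u @ a, p, b @ v))"

definition isotopy_step :: "layer list \<Rightarrow> layer list \<Rightarrow> bool" where
  "isotopy_step K K' \<longleftrightarrow> link_diagram K \<and> link_diagram K' \<and>
     (\<exists>P Q L L' u v. local_move L L' \<and>
        K = P @ whisker u v L @ Q \<and> K' = P @ whisker u v L' @ Q)"

definition regularly_isotopic :: "layer list \<Rightarrow> layer list \<Rightarrow> bool" where
  "regularly_isotopic = equivclp isotopy_step"

section \<open>The matrix model\<close>

(* P and Q are lists of pairs of matrices, read as the sums Rep(rho) and Rep(rho_inv).
   The arguments a, b, c, d of a crossing entry are the upper left, upper right, lower left and
   lower right colors. *)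

definition R_up :: "(('k::comm_ring_1^'n^'n) \<times> ('k^'n^'n)) list \<Rightarrow> 'n \<Rightarrow> 'n \<Rightarrow> 'n \<Rightarrow> 'n \<Rightarrow> 'k" where
  "R_up P a b c d = (\<Sum>(e, e')\<leftarrow>P. e $ c $ b * e' $ d $ a)"

definition S_up :: "(('k::comm_ring_1^'n^'n) \<times> ('k^'n^'n)) list \<Rightarrow> 'n \<Rightarrow> 'n \<Rightarrow> 'n \<Rightarrow> 'n \<Rightarrow> 'k" where
  "S_up Q a b c d = (\<Sum>(E, E')\<leftarrow>Q. E $ d $ a * E' $ c $ b)"

fun cap_entry :: "'k::comm_ring_1^'n^'n \<Rightarrow> dir \<Rightarrow> 'n \<Rightarrow> 'n \<Rightarrow> 'k" where
  "cap_entry M Up a b = M $ a $ b"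
| "cap_entry M Down a b = matrix_inv M $ b $ a"

fun cup_entry :: "'k::comm_ring_1^'n^'n \<Rightarrow> dir \<Rightarrow> 'n \<Rightarrow> 'n \<Rightarrow> 'k" where
  "cup_entry M Down a b = matrix_inv M $ a $ b"
| "cup_entry M Up a b = M $ b $ a"

(* Entries for both strands pointing down. *)
definition turned :: "('n \<Rightarrow> 'n \<Rightarrow> 'n \<Rightarrow> 'n \<Rightarrow> 'k) \<Rightarrow> 'n \<Rightarrow> 'n \<Rightarrow> 'n \<Rightarrow> 'n \<Rightarrow> 'k" where
  "turned X a b c d = X d c b a"

(* X is R_up P or S_up Q; the directions are those at the lower left and lower right, so that
   (Down, Up) is the crossing with both strands pointing left. *)
fun cross_entry ::
  "'k::comm_ring_1^'n^'n \<Rightarrow> ('n::finite \<Rightarrow> 'n \<Rightarrow> 'n \<Rightarrow> 'n \<Rightarrow> 'k) \<Rightarrow> dir \<Rightarrow> dir \<Rightarrow> 'n \<Rightarrow> 'n \<Rightarrow> 'n \<Rightarrow> 'n \<Rightarrow> 'k" where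
  "cross_entry M X Up Up a b c d = X a b c d"
| "cross_entry M X Down Down a b c d = turned X a b c d"
| "cross_entry M X Down Up a b c d =
     (\<Sum>i\<in>UNIV. \<Sum>j\<in>UNIV. cap_entry M Down c i * X i a d j * cup_entry M Up j b)"
| "cross_entry M X Up Down a b c d =
     (\<Sum>i\<in>UNIV. \<Sum>j\<in>UNIV.
        cap_entry M Up c i * turned X i a d j * cup_entry M Down j b)"

definition positive_crossing :: "bool \<Rightarrow> dir \<Rightarrow> dir \<Rightarrow> bool" where
  "positive_crossing ov s t \<longleftrightarrow> (if s = t then ov else \<not> ov)"

(* The color lists are those of the ends at the bottom and at the top of the piece. *)
fun piece_entry ::
  "(('k::comm_ring_1^'n::finite^'n) \<times> ('k^'n^'n)) list \<Rightarrow> (('k^'n^'n) \<times> ('k^'n^'n)) list \<Rightarrow> 'k^'n^'n \<Rightarrow>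
     piece \<Rightarrow> 'n list \<Rightarrow> 'n list \<Rightarrow> 'k" where
  "piece_entry P Q M (Cap s) [a, b] [] = cap_entry M s a b"
| "piece_entry P Q M (Cup s) [] [a, b] = cup_entry M s a b"
| "piece_entry P Q M (Cross ov s t) [c, d] [a, b] =
     cross_entry M (if positive_crossing ov s t then R_up P else S_up Q) s t a b c d"
| "piece_entry P Q M _ _ _ = 0"

(* The marked point of an arc is represented by all the intersections of the arc with the levels
   between the layers: a coloring lists the colors on the levels, and a strand that runs vertically
   through a layer keeps its color. *)
fun layer_coloring :: "layer \<Rightarrow> 'n list \<Rightarrow> 'n list \<Rightarrow> bool" where
  "layer_coloring (u, p, v) x y \<longleftrightarrow>
     length x = length (source (u, p, v)) \<and> length y = length (target (u, p, v)) \<and>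
     take (length u) x = take (length u) y \<and>
     drop (length u + length (bot p)) x = drop (length u + length (top p)) y"

definition colorings :: "layer list \<Rightarrow> 'n list list set" where
  "colorings K = {cs. length cs = Suc (length K) \<and> cs ! 0 = [] \<and>
     (\<forall>i<length K. layer_coloring (K ! i) (cs ! i) (cs ! Suc i))}"

fun layer_entry ::
  "(('k::comm_ring_1^'n::finite^'n) \<times> ('k^'n^'n)) list \<Rightarrow> (('k^'n^'n) \<times> ('k^'n^'n)) list \<Rightarrow> 'k^'n^'n \<Rightarrow>
     layer \<Rightarrow> 'n list \<Rightarrow> 'n list \<Rightarrow> 'k" where
  "layer_entry P Q M (u, p, v) x y =
     piece_entry P Q M p (take (length (bot p)) (drop (length u) x))
       (take (length (top p)) (drop (length u) y))"

definition state_sum ::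
  "(('k::comm_ring_1^'n::finite^'n) \<times> ('k^'n^'n)) list \<Rightarrow> (('k^'n^'n) \<times> ('k^'n^'n)) list \<Rightarrow> 'k^'n^'n \<Rightarrow>
     layer list \<Rightarrow> 'k" where
  "state_sum P Q M K =
     (\<Sum>cs\<in>colorings K. \<Prod>i<length K. layer_entry P Q M (K ! i) (cs ! i) (cs ! Suc i))"

end

theory Submission
  imports Defs
begin

text \<open>
  The weight of a strand is the product, taken along its orientation, of the matrices that it meets:
  the factors of \<open>\<rho>\<close> or \<open>\<rho>\<^sup>-\<^sup>1\<close> at crossings, \<open>M\<close> at clockwise turns and \<open>M\<^sup>-\<^sup>1\<close> at
  counterclockwise ones.  The state sum is local: it is an iterated transfer of functions of
  boundary colors, so each local move only requires that its two sides define the same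
  transfer, for every choice of what lies above (\<open>evaluate_local_move\<close>).

  Turning a crossing by a quarter, with a cap on one side and a cup on the other, gives the crossing
  tensor with the rotated directions (\<open>crossing_rotate\<close>).  For strands of different
  directions this is the definition of the tensor; otherwise two quarter turns are composed,
  which conjugates both tensor factors by \<open>M\<close>, and this is where
  \<open>(T \<otimes> T)\<rho> = \<rho>\<close> enters.  The switchback moves are this rotation with one of
  the two turns moved to the other side.

  For the second Reidemeister move, parallel strands need \<open>\<rho>\<rho>\<^sup>-\<^sup>1 = \<rho>\<^sup>-\<^sup>1\<rho> = 1\<close> in
  \<open>A \<otimes> A\<close>.  Antiparallel strands compose one of the two tensor factors in the opposite order, so
  they need the inverse relation in \<open>A \<otimes> A\<^sup>o\<^sup>p\<close> (\<open>crossing_inverse\<close>).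

  For the third Reidemeister move, only one of its many versions is computed: three upward strands,
  the leftmost at the bottom being the highest and the rightmost the lowest, where the move is the
  Yang-Baxter equation.
  Multiplying this identity by inverse crossings exchanges two neighboring strands
  (\<open>triangle_flip_first\<close>, \<open>triangle_flip_last\<close>), which gives all heights.  Pulling the lower left end
  of the triangle up and its upper right end down (\<open>triangle_rotate\<close>) changes the directions
  \<open>(s, t, r)\<close> into \<open>(t, r, opp s)\<close>.  The six triangles that are not cyclically oriented form one orbit
  of this rotation, and the two cyclic ones arise from them by a flip.
\<close>

section \<open>The state sum as an iterated transfer\<close>

text \<open>
  A function of the colors at the top of a diagram is pulled back to a function of the colors at its
  bottom.  Each layer sums only over the colors that its own piece creates, so vertical strands cost
  nothing.  A color list of the wrong length is sent to 0, which agrees with an empty sum over colorings.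
\<close>

primrec evaluate ::
  "(('k::comm_ring_1^'n::finite^'n) \<times> ('k^'n^'n)) list \<Rightarrow> (('k^'n^'n) \<times> ('k^'n^'n)) list \<Rightarrow> 'k^'n^'n \<Rightarrow>
     layer list \<Rightarrow> ('n list \<Rightarrow> 'k) \<Rightarrow> 'n list \<Rightarrow> 'k" where
  "evaluate P Q M [] f x = f x"
| "evaluate P Q M (l # L) f x = (case l of (u, p, v) \<Rightarrow>
     if length x = length (source l) then
       \<Sum>z | length z = length (top p).
         piece_entry P Q M p (take (length (bot p)) (drop (length u) x)) z *
         evaluate P Q M L f (take (length u) x @ z @ drop (length u + length (bot p)) x)
     else 0)"

lemma finite_lists_length: "finite {z :: 'n::finite list. length z = m}"
  using finite_lists_length_eq[of "UNIV :: 'n set" m] by simp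

lemma layer_coloring_iff:
  assumes "length x = length (source (u, p, v))"
  shows "layer_coloring (u, p, v) x y \<longleftrightarrow>
    (\<exists>z. length z = length (top p) \<and> y = take (length u) x @ z @ drop (length u + length (bot p)) x)"
proof
  assume c: "layer_coloring (u, p, v) x y"
  let ?z = "take (length (top p)) (drop (length u) y)"
  have "y = take (length u) y @ ?z @ drop (length u + length (top p)) y"
    by (metis add.commute append_take_drop_id drop_drop)
  with c have "y = take (length u) x @ ?z @ drop (length u + length (bot p)) x"
    by simp
  moreover have "length ?z = length (top p)" using c by simp
  ultimately show "\<exists>z. length z = length (top p) \<and> y = take (length u) x @ z @ drop (length u + length (bot p)) x"
    by blast
next
  assume "\<exists>z. length z = length (top p) \<and> y = take (length u) x @ z @ drop (length u + length (bot p)) x"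
  then show "layer_coloring (u, p, v) x y" using assms by (auto simp: min_def)
qed

text \<open>
  The empty list of bottom colors in \<open>colorings\<close> has to vary for an induction over the layers.
\<close>

definition colorings_from :: "'n list \<Rightarrow> layer list \<Rightarrow> 'n list list set" where
  "colorings_from x K = {cs. length cs = Suc (length K) \<and> cs ! 0 = x \<and>
     (\<forall>i<length K. layer_coloring (K ! i) (cs ! i) (cs ! Suc i))}"

lemma colorings_from_Nil: "colorings_from x [] = {[x]}"
  by (auto simp: colorings_from_def length_Suc_conv)

lemma colorings_from_Cons:
  "colorings_from x (l # K) = (#) x ` (\<Union>y \<in> {y. layer_coloring l x y}. colorings_from y K)"
  (is "_ = ?R")
proof (rule Set.set_eqI)
  fix cs
  show "cs \<in> colorings_from x (l # K) \<longleftrightarrow> cs \<in> ?R"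
    by (cases cs; cases "tl cs") (auto simp: colorings_from_def All_less_Suc2 image_iff)
qed

lemma finite_layer_coloring: "finite {y :: 'n::finite list. layer_coloring l x y}"
  by (cases l) (auto intro: finite_subset[OF _ finite_lists_length])

lemma finite_colorings_from: "finite (colorings_from (x :: 'n::finite list) K)"
  by (induction K arbitrary: x) (auto simp: colorings_from_Nil colorings_from_Cons finite_layer_coloring)

lemma sum_colorings_from:
  "(\<Sum>cs\<in>colorings_from x K. \<Prod>i<length K. layer_entry P Q M (K ! i) (cs ! i) (cs ! Suc i)) =
   evaluate P Q M K (\<lambda>_. 1) x"
proof (induction K arbitrary: x)
  case Nil
  show ?case by (simp add: colorings_from_Nil)
next
  case (Cons l K)
  obtain u p v where l: "l = (u, p, v)" by (cases l)
  let ?w = "\<lambda>K cs. \<Prod>i<length K. layer_entry P Q M (K ! i) (cs ! i) (cs ! Suc i)"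
  let ?y = "\<lambda>z. take (length u) x @ z @ drop (length u + length (bot p)) x"
  have "(\<Sum>cs\<in>colorings_from x (l # K). ?w (l # K) cs) =
      (\<Sum>cs\<in>(\<Union>y \<in> {y. layer_coloring l x y}. colorings_from y K). layer_entry P Q M l x (cs ! 0) * ?w K cs)"
    unfolding colorings_from_Cons
    by (subst sum.reindex) (auto simp: prod.lessThan_Suc_shift simp del: prod.lessThan_Suc)
  also have "\<dots> = (\<Sum>y | layer_coloring l x y. \<Sum>cs\<in>colorings_from y K. layer_entry P Q M l x (cs ! 0) * ?w K cs)"
    by (rule sum.UNION_disjoint)
      (auto simp: finite_layer_coloring finite_colorings_from, auto simp: colorings_from_def)
  also have "\<dots> = (\<Sum>y | layer_coloring l x y. layer_entry P Q M l x y * evaluate P Q M K (\<lambda>_. 1) y)"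
    unfolding Cons.IH[symmetric] sum_distrib_left
    by (intro sum.cong refl) (simp add: colorings_from_def)
  also have "\<dots> = evaluate P Q M (l # K) (\<lambda>_. 1) x"
  proof (cases "length x = length (source l)")
    case True
    then have "{y. layer_coloring l x y} = ?y ` {z. length z = length (top p)}"
      using layer_coloring_iff[of x u p v] by (auto simp: l simp del: layer_coloring.simps)
    moreover have "inj_on ?y {z. length z = length (top p)}"
      by (rule inj_onI) simp
    ultimately show ?thesis
      using True by (simp add: l sum.reindex min_def)
  next
    case False
    then have "{y. layer_coloring l x y} = {}" by (auto simp: l)
    with False show ?thesis by (simp add: l)
  qed
  finally show ?case .
qed

lemma state_sum_evaluate: "state_sum P Q M K = evaluate P Q M K (\<lambda>_. 1) []"
  using sum_colorings_from[where x = "[]" and P = P and Q = Q and M = M and K = K]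
  by (simp add: state_sum_def colorings_def colorings_from_def)

lemma evaluate_append: "evaluate P Q M (L @ L') f = evaluate P Q M L (evaluate P Q M L' f)"
proof
  show "evaluate P Q M (L @ L') f x = evaluate P Q M L (evaluate P Q M L' f) x" for x
    by (induction L arbitrary: x) (auto split: prod.splits intro!: sum.cong)
qed

text \<open>
  Equality of the pulled back functions is only needed on lists of the right length.  This matters for
  moves whose right side is the empty diagram: it acts as the identity also on lists of other lengths,
  where the left side gives 0.
\<close>

lemma evaluate_cong:
  assumes "successively (\<lambda>l l'. target l = source l') L"
    and "\<And>y. length y = (if L = [] then length x else length (target (last L))) \<Longrightarrow> f y = g y"
  shows "evaluate P Q M L f x = evaluate P Q M L g x"
  using assms
proof (induction L arbitrary: x)
  case (Cons l L)
  obtain u p v where l: "l = (u, p, v)" by (cases l)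
  show ?case
  proof (cases "length x = length (source l)")
    case True
    have "evaluate P Q M L f y = evaluate P Q M L g y" if "length y = length (target l)" for y
      using Cons.prems that by (intro Cons.IH) (auto simp: successively_Cons split: if_splits)
    then show ?thesis using True by (auto simp: l intro!: sum.cong)
  qed (simp add: l)
qed simp

lemma evaluate_whisker:
  assumes "length x1 = length u" "length x3 = length v"
  shows "evaluate P Q M (whisker u v L) f (x1 @ x2 @ x3) =
    evaluate P Q M L (\<lambda>y. f (x1 @ y @ x3)) x2"
proof (induction L arbitrary: x2)
  case (Cons l L)
  obtain a p b where l: "l = (a, p, b)" by (cases l)
  let ?W = "whisker u v L"
  have w: "whisker u v (l # L) = (u @ a, p, b @ v) # ?W" by (simp add: whisker_def l)
  show ?case
  proof (cases "length x2 = length (source l)")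
    case True
    have "evaluate P Q M ?W f (take (length u + length a) (x1 @ x2 @ x3) @ z @
        drop (length u + length a + length (bot p)) (x1 @ x2 @ x3)) =
      evaluate P Q M L (\<lambda>y. f (x1 @ y @ x3)) (take (length a) x2 @ z @ drop (length a + length (bot p)) x2)" for z
      using True assms Cons.IH[of "take (length a) x2 @ z @ drop (length a + length (bot p)) x2"]
      by (simp add: l)
    moreover have "take (length (bot p)) (drop (length u + length a) (x1 @ x2 @ x3)) =
       take (length (bot p)) (drop (length a) x2)" using True assms by (simp add: l)
    ultimately show ?thesis using True assms unfolding w by (simp add: l)
  qed (use assms in \<open>unfold w, simp add: l\<close>)
qed (simp add: whisker_def)

text \<open>
  The diagram below the move fixes the number of strands that enter it, and the diagram above it is
  absorbed into the function \<open>f\<close> of the local hypothesis.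
\<close>

lemma state_sum_isotopy_step:
  fixes M :: "'k::comm_ring_1^'n::finite^'n"
  assumes step: "isotopy_step K K'"
    and local: "\<And>L L' f x. \<lbrakk>local_move L L'; length x = length (source (hd L))\<rbrakk> \<Longrightarrow>
      evaluate P Q M L f x = evaluate P Q M L' f x"
  shows "state_sum P Q M K = state_sum P Q M K'"
proof -
  from step obtain F G L L' u v where K: "link_diagram K" and m: "local_move L L'"
    and eqs: "K = F @ whisker u v L @ G" "K' = F @ whisker u v L' @ G"
    unfolding isotopy_step_def by blast
  from m have ne: "L \<noteq> []" by cases auto
  then have hd_w: "hd (whisker u v L @ G) = (u @ fst (hd L), fst (snd (hd L)), snd (snd (hd L)) @ v)"
    and ne_w: "whisker u v L \<noteq> []"
    by (auto simp: whisker_def hd_map case_prod_beta)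
  have src: "length (source (hd (whisker u v L @ G))) = length u + length (source (hd L)) + length v"
    unfolding hd_w by (cases "hd L") simp
  have len: "(if F = [] then length ([] :: 'n list) else length (target (last F))) =
      length (source (hd (whisker u v L @ G)))"
    using K ne_w unfolding link_diagram_def eqs(1)
    by (cases "F = []") (auto simp: successively_append_iff)
  have "evaluate P Q M F (evaluate P Q M (whisker u v L @ G) (\<lambda>_. 1)) [] =
        evaluate P Q M F (evaluate P Q M (whisker u v L' @ G) (\<lambda>_. 1)) []"
  proof (rule evaluate_cong)
    show "successively (\<lambda>l l'. target l = source l') F"
      using K unfolding link_diagram_def eqs(1) by (simp add: successively_append_iff)
  next
    fix y :: "'n list"
    assume "length y = (if F = [] then length ([] :: 'n list) else length (target (last F)))"
    then have y: "length y = length u + length (source (hd L)) + length v"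
      unfolding len src .
    define x1 x2 x3 where "x1 = take (length u) y" and "x2 = take (length (source (hd L))) (drop (length u) y)"
      and "x3 = drop (length u + length (source (hd L))) y"
    have "y = x1 @ x2 @ x3" and l: "length x1 = length u" "length x2 = length (source (hd L))" "length x3 = length v"
      using y unfolding x1_def x2_def x3_def
      by (auto simp: min_def) (metis add.commute append_take_drop_id drop_drop)
    then show "evaluate P Q M (whisker u v L @ G) (\<lambda>_. 1) y = evaluate P Q M (whisker u v L' @ G) (\<lambda>_. 1) y"
      by (simp add: evaluate_append evaluate_whisker local[OF m])
  qed
  then show ?thesis by (simp add: state_sum_evaluate eqs evaluate_append)
qed

lemma state_sum_regularly_isotopic:
  assumes "regularly_isotopic K K'"
    and local: "\<And>L L' f x. \<lbrakk>local_move L L'; length x = length (source (hd L))\<rbrakk> \<Longrightarrow>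
      evaluate P Q M L f x = evaluate P Q M L' f x"
  shows "state_sum P Q M K = state_sum P Q M K'"
  using assms(1) unfolding regularly_isotopic_def
  by (induction rule: equivclp_induct) (use state_sum_isotopy_step[OF _ local] in \<open>metis+\<close>)

section \<open>Entries of tensors of matrices\<close>

text \<open>
  Equality in a tensor product is a congruence generated by relations, so any additive valuation that
  respects the generators respects it.  Products of matrix entries are such valuations.
\<close>

lemma sum_congruence_sum_list:
  fixes h :: "'s \<Rightarrow> 'b::comm_monoid_add"
  assumes "\<And>X Y. G X Y \<Longrightarrow> (\<Sum>s\<leftarrow>X. h s) = (\<Sum>s\<leftarrow>Y. h s)"
    and "sum_congruence G X Y"
  shows "(\<Sum>s\<leftarrow>X. h s) = (\<Sum>s\<leftarrow>Y. h s)"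
  using assms(2) by induction (auto simp: assms(1) add.commute)

lemma tensor2_eq_entries:
  assumes "tensor2_eq (matrix_algebra\<lparr>carrier := S\<rparr>) X Y"
  shows "(\<Sum>(x, y)\<leftarrow>X. x $ i $ j * y $ k $ l) = (\<Sum>(x, y)\<leftarrow>Y. x $ i $ j * y $ k $ l)"
  using assms unfolding tensor2_eq_def
  by (rule sum_congruence_sum_list[rotated], elim tensor2_rel.cases)
    (auto simp: matrix_algebra_def algebra_simps)

lemma tensor3_eq_entries:
  assumes "tensor3_eq (matrix_algebra\<lparr>carrier := S\<rparr>) X Y"
  shows "(\<Sum>(x, y, z)\<leftarrow>X. x $ i $ j * y $ k $ l * z $ m $ n) =
    (\<Sum>(x, y, z)\<leftarrow>Y. x $ i $ j * y $ k $ l * z $ m $ n)"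
  using assms unfolding tensor3_eq_def
  by (rule sum_congruence_sum_list[rotated], elim tensor3_rel.cases)
    (auto simp: matrix_algebra_def algebra_simps)

lemma sum_list_nth: "(\<Sum>s\<leftarrow>X. h s) = (\<Sum>i<length X. h (X ! i))"
  by (simp add: sum_list_sum_nth atLeast0LessThan)

lemma sum_list_concat_map: "(\<Sum>s\<leftarrow>concat (map F X). h s) = (\<Sum>x\<leftarrow>X. \<Sum>s\<leftarrow>F x. h s)"
  by (induction X) auto

lemma tensor2_mult_entries:
  "(\<Sum>(x, y)\<leftarrow>tensor2_mult (matrix_algebra\<lparr>carrier := S\<rparr>) X Y. x $ i $ j * y $ k $ l) =
   (\<Sum>x<length X. \<Sum>y<length Y. (fst (X ! x) ** fst (Y ! y)) $ i $ j * (snd (X ! x) ** snd (Y ! y)) $ k $ l)"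
  by (simp add: tensor2_mult_def matrix_algebra_def sum_list_concat_map case_prod_unfold o_def)
    (simp add: sum_list_nth)

lemma tensor2_mult_op_entries:
  "(\<Sum>(x, y)\<leftarrow>tensor2_mult_op (matrix_algebra\<lparr>carrier := S\<rparr>) X Y. x $ i $ j * y $ k $ l) =
   (\<Sum>x<length X. \<Sum>y<length Y. (fst (X ! x) ** fst (Y ! y)) $ i $ j * (snd (Y ! y) ** snd (X ! x)) $ k $ l)"
  by (simp add: tensor2_mult_op_def matrix_algebra_def sum_list_concat_map case_prod_unfold o_def)
    (simp add: sum_list_nth)

lemma tensor3_mult_entries:
  "(\<Sum>(x, y, z)\<leftarrow>tensor3_mult (matrix_algebra\<lparr>carrier := S\<rparr>) (tensor3_mult (matrix_algebra\<lparr>carrier := S\<rparr>) X Y) Z.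
     x $ i $ j * y $ k $ l * z $ g $ h) =
   (\<Sum>(x, x', x'')\<leftarrow>X. \<Sum>(y, y', y'')\<leftarrow>Y. \<Sum>(z, z', z'')\<leftarrow>Z.
     (x ** y ** z) $ i $ j * (x' ** y' ** z') $ k $ l * (x'' ** y'' ** z'') $ g $ h)"
  by (simp add: tensor3_mult_def matrix_algebra_def sum_list_concat_map case_prod_unfold o_def)

section \<open>Crossing tensors, their inverses and rotations\<close>

lemma sum_product3: "(\<Sum>x\<in>A. f x) * (\<Sum>y\<in>B. g y) * (\<Sum>z\<in>C. h z) = (\<Sum>x\<in>A. \<Sum>y\<in>B. \<Sum>z\<in>C. f x * g y * h z)"
  for f g h :: "_ \<Rightarrow> 'k::comm_ring_1"
proof -
  have eq: "(\<Sum>x\<in>A. f x) * (\<Sum>y\<in>B. g y) * H = (\<Sum>x\<in>A. \<Sum>y\<in>B. f x * g y * H)" for H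
    unfolding sum_product[of f A g B] by (simp only: sum_distrib_right)
  show ?thesis by (subst eq) (simp only: sum_distrib_left)
qed

text \<open>
  A crossing tensor \<open>X a b c d\<close> (upper left, upper right, lower left, lower right) acts on functions of
  the colors of three strands.  As operators, diagrams are composed by \<open>\<circ>\<close> with the lowest
  layer outermost, and the associativity of \<open>\<circ>\<close> replaces exchanges of sums.
\<close>

definition op12 :: "('n::finite \<Rightarrow> 'n \<Rightarrow> 'n \<Rightarrow> 'n \<Rightarrow> 'k::comm_ring_1) \<Rightarrow> ('n \<Rightarrow> 'n \<Rightarrow> 'n \<Rightarrow> 'k) \<Rightarrow> ('n \<Rightarrow> 'n \<Rightarrow> 'n \<Rightarrow> 'k)"
  where "op12 X f c1 c2 c3 = (\<Sum>p\<in>UNIV. \<Sum>q\<in>UNIV. X p q c1 c2 * f p q c3)"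

definition op23 :: "('n::finite \<Rightarrow> 'n \<Rightarrow> 'n \<Rightarrow> 'n \<Rightarrow> 'k::comm_ring_1) \<Rightarrow> ('n \<Rightarrow> 'n \<Rightarrow> 'n \<Rightarrow> 'k) \<Rightarrow> ('n \<Rightarrow> 'n \<Rightarrow> 'n \<Rightarrow> 'k)"
  where "op23 X f c1 c2 c3 = (\<Sum>p\<in>UNIV. \<Sum>q\<in>UNIV. X p q c2 c3 * f c1 p q)"

text \<open>
  The third Reidemeister move: \<open>X\<close>, \<open>Y\<close> and \<open>Z\<close> belong to the crossings of the strands 1 and 2,
  1 and 3, 2 and 3, numbered from left to right at the bottom.
\<close>

definition triangle :: "('n::finite \<Rightarrow> 'n \<Rightarrow> 'n \<Rightarrow> 'n \<Rightarrow> 'k::comm_ring_1) \<Rightarrow> ('n \<Rightarrow> 'n \<Rightarrow> 'n \<Rightarrow> 'n \<Rightarrow> 'k) \<Rightarrow>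
    ('n \<Rightarrow> 'n \<Rightarrow> 'n \<Rightarrow> 'n \<Rightarrow> 'k) \<Rightarrow> bool"
  where "triangle X Y Z \<longleftrightarrow> op12 X \<circ> op23 Y \<circ> op12 Z = op23 Z \<circ> op12 Y \<circ> op23 X"

definition inverse_crossings :: "('n::finite \<Rightarrow> 'n \<Rightarrow> 'n \<Rightarrow> 'n \<Rightarrow> 'k::comm_ring_1) \<Rightarrow> ('n \<Rightarrow> 'n \<Rightarrow> 'n \<Rightarrow> 'n \<Rightarrow> 'k) \<Rightarrow> bool"
  where "inverse_crossings X X' \<longleftrightarrow> (\<forall>a b c d.
    (\<Sum>p\<in>UNIV. \<Sum>q\<in>UNIV. X p q c d * X' a b p q) = mat 1 $ c $ a * mat 1 $ d $ b)"

lemma sum_mat_1_left: "(\<Sum>a\<in>UNIV. mat 1 $ c $ a * h a) = (h c :: 'k::comm_ring_1)" for c :: "'n::finite"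
  by (simp add: mat_def if_distrib[of "\<lambda>x. x * _"] cong: if_cong)

lemma sum_mat_1_right: "(\<Sum>a\<in>UNIV. h a * mat 1 $ a $ c) = (h c :: 'k::comm_ring_1)" for c :: "'n::finite"
  by (simp add: mat_def if_distrib[of "\<lambda>x. _ * x"] cong: if_cong)

lemma sum_mat_1_triple:
  fixes h :: "'n::finite \<Rightarrow> 'n \<Rightarrow> 'n \<Rightarrow> 'k::comm_ring_1"
  shows "(\<Sum>a\<in>UNIV. \<Sum>b\<in>UNIV. \<Sum>c\<in>UNIV. h a b c * (mat 1 $ a $ i * mat 1 $ b $ j * mat 1 $ c $ l)) = h i j l"
  by (simp only: mult.assoc[symmetric] sum_mat_1_right)

lemma inverse_crossings_apply:
  assumes "inverse_crossings X X'"
  shows "(\<Sum>p\<in>UNIV. \<Sum>q\<in>UNIV. X p q c d * (\<Sum>a\<in>UNIV. \<Sum>b\<in>UNIV. X' a b p q * f a b)) = f c d"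
proof -
  have "(\<Sum>p\<in>UNIV. \<Sum>q\<in>UNIV. X p q c d * (\<Sum>a\<in>UNIV. \<Sum>b\<in>UNIV. X' a b p q * f a b)) =
     (\<Sum>a\<in>UNIV. \<Sum>b\<in>UNIV. (\<Sum>p\<in>UNIV. \<Sum>q\<in>UNIV. X p q c d * X' a b p q) * f a b)"
    unfolding sum_distrib_left sum_distrib_right sum.cartesian_product
    by (rule sum.reindex_bij_witness[where i = "\<lambda>(a, b, p, q). (p, q, a, b)" and j = "\<lambda>(p, q, a, b). (a, b, p, q)"])
      (auto simp: mult_ac)
  also have "\<dots> = (\<Sum>a\<in>UNIV. mat 1 $ c $ a * (\<Sum>b\<in>UNIV. mat 1 $ d $ b * f a b))"
    using assms by (simp add: inverse_crossings_def sum_distrib_left mult_ac)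
  finally show ?thesis by (simp add: sum_mat_1_left)
qed

lemma op_inverse:
  assumes "inverse_crossings X X'"
  shows "op12 X \<circ> op12 X' = id" and "op23 X \<circ> op23 X' = id"
  by (intro ext; simp add: op12_def op23_def inverse_crossings_apply[OF assms, where f = "\<lambda>a b. _ a b _"]
    inverse_crossings_apply[OF assms])+

text \<open>
  Composing both sides with \<open>X'\<close> at the bottom and at the top cancels \<open>X\<close> and moves the crossing of
  the strands 1 and 2 to the other side.  What remains is a triangle with the strands in the order 2, 1, 3.
\<close>

lemma triangle_flip_first:
  assumes XYZ: "triangle X Y Z" and "inverse_crossings X' X" "inverse_crossings X X'"
  shows "triangle X' Z Y"
proof -
  have "op23 Y \<circ> op12 Z \<circ> op23 X' = (op12 X' \<circ> op12 X) \<circ> op23 Y \<circ> op12 Z \<circ> op23 X'"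
    by (simp add: op_inverse assms)
  also have "\<dots> = op12 X' \<circ> (op12 X \<circ> op23 Y \<circ> op12 Z) \<circ> op23 X'" by (simp add: comp_assoc)
  also have "\<dots> = op12 X' \<circ> op23 Z \<circ> op12 Y \<circ> (op23 X \<circ> op23 X')"
    using XYZ by (simp add: comp_assoc triangle_def)
  finally show ?thesis by (simp add: triangle_def op_inverse assms)
qed

text \<open>
  The same for the crossing of the strands 2 and 3: the order becomes 1, 3, 2.
\<close>

lemma triangle_flip_last:
  assumes XYZ: "triangle X Y Z" and "inverse_crossings Z' Z" "inverse_crossings Z Z'"
  shows "triangle Y X Z'"
proof -
  have "op12 Y \<circ> op23 X \<circ> op12 Z' = (op23 Z' \<circ> op23 Z) \<circ> op12 Y \<circ> op23 X \<circ> op12 Z'"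
    by (simp add: op_inverse assms)
  also have "\<dots> = op23 Z' \<circ> (op23 Z \<circ> op12 Y \<circ> op23 X) \<circ> op12 Z'" by (simp add: comp_assoc)
  also have "\<dots> = op23 Z' \<circ> (op12 X \<circ> op23 Y \<circ> op12 Z) \<circ> op12 Z'"
    using XYZ by (simp add: triangle_def)
  also have "\<dots> = op23 Z' \<circ> op12 X \<circ> op23 Y \<circ> (op12 Z \<circ> op12 Z')"
    by (simp add: comp_assoc)
  finally show ?thesis by (simp add: triangle_def op_inverse assms)
qed

text \<open>
  Coefficients of the two sides of the triangle, from the bottom colors \<open>c1, c2, c3\<close> to the top colors
  \<open>a1, a2, a3\<close>.  Unlike the operators, they allow an end of a strand to be bent.
\<close>

definition lower_triangle where
  "lower_triangle X Y Z c1 c2 c3 a1 a2 a3 =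
     (\<Sum>p\<in>UNIV. \<Sum>q\<in>UNIV. \<Sum>w\<in>UNIV. X p q c1 c2 * Y w a3 q c3 * Z a1 a2 p w)"

definition upper_triangle where
  "upper_triangle X Y Z c1 c2 c3 a1 a2 a3 =
     (\<Sum>p\<in>UNIV. \<Sum>q\<in>UNIV. \<Sum>w\<in>UNIV. Z p q c2 c3 * Y a1 w c1 p * X a2 a3 w q)"

lemma op_lower_triangle:
  "op12 X (op23 Y (op12 Z f)) c1 c2 c3 =
    (\<Sum>a1\<in>UNIV. \<Sum>a2\<in>UNIV. \<Sum>a3\<in>UNIV. lower_triangle X Y Z c1 c2 c3 a1 a2 a3 * f a1 a2 a3)"
  unfolding op12_def op23_def lower_triangle_def sum_distrib_left sum_distrib_right sum.cartesian_product
  by (rule sum.reindex_bij_witness[where i = "\<lambda>(a1, a2, a3, p, q, w). (p, q, w, a3, a1, a2)"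
        and j = "\<lambda>(p, q, w, a3, a1, a2). (a1, a2, a3, p, q, w)"])
    (auto simp: mult_ac)

lemma op_upper_triangle:
  "op23 Z (op12 Y (op23 X f)) c1 c2 c3 =
    (\<Sum>a1\<in>UNIV. \<Sum>a2\<in>UNIV. \<Sum>a3\<in>UNIV. upper_triangle X Y Z c1 c2 c3 a1 a2 a3 * f a1 a2 a3)"
  unfolding op12_def op23_def upper_triangle_def sum_distrib_left sum_distrib_right sum.cartesian_product
  by (rule sum.reindex_bij_witness[where i = "\<lambda>(a1, a2, a3, p, q, w). (p, q, a1, w, a2, a3)"
        and j = "\<lambda>(p, q, a1, w, a2, a3). (a1, a2, a3, p, q, w)"])
    (auto simp: mult_ac)

lemma triangle_iff_entries:
  "triangle X Y Z \<longleftrightarrow> (\<forall>c1 c2 c3 a1 a2 a3.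
     lower_triangle X Y Z c1 c2 c3 a1 a2 a3 = upper_triangle X Y Z c1 c2 c3 a1 a2 a3)"
proof
  assume XYZ: "triangle X Y Z"
  have "op12 X (op23 Y (op12 Z f)) = op23 Z (op12 Y (op23 X f))" for f
    using fun_cong[OF XYZ[unfolded triangle_def], of f] by simp
  then have eq: "(\<Sum>a1\<in>UNIV. \<Sum>a2\<in>UNIV. \<Sum>a3\<in>UNIV. lower_triangle X Y Z c1 c2 c3 a1 a2 a3 * f a1 a2 a3) =
      (\<Sum>a1\<in>UNIV. \<Sum>a2\<in>UNIV. \<Sum>a3\<in>UNIV. upper_triangle X Y Z c1 c2 c3 a1 a2 a3 * f a1 a2 a3)" for f c1 c2 c3
    by (simp only: flip: op_lower_triangle op_upper_triangle)
  show "\<forall>c1 c2 c3 a1 a2 a3.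
     lower_triangle X Y Z c1 c2 c3 a1 a2 a3 = upper_triangle X Y Z c1 c2 c3 a1 a2 a3"
  proof (intro allI)
    fix c1 c2 c3 b1 b2 b3
    show "lower_triangle X Y Z c1 c2 c3 b1 b2 b3 = upper_triangle X Y Z c1 c2 c3 b1 b2 b3"
      \<comment> \<open>The coefficients are recovered by applying the operators to a delta function.\<close>
      using eq[of c1 c2 c3 "\<lambda>a1 a2 a3. mat 1 $ a1 $ b1 * mat 1 $ a2 $ b2 * mat 1 $ a3 $ b3"]
      by (simp only: sum_mat_1_triple)
  qed
next
  assume "\<forall>c1 c2 c3 a1 a2 a3.
     lower_triangle X Y Z c1 c2 c3 a1 a2 a3 = upper_triangle X Y Z c1 c2 c3 a1 a2 a3"
  then show "triangle X Y Z"
    by (intro triangle_def[THEN iffD2] ext) (simp add: op_lower_triangle op_upper_triangle)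
qed

text \<open>
  A quarter turn counterclockwise: the upper left end of \<open>X\<close> is pulled down by a cap to become the
  lower left end, and the lower right end is pulled up by a cup to become the upper right end.
\<close>

definition rotate_crossing :: "('n::finite \<Rightarrow> 'n \<Rightarrow> 'k::comm_ring_1) \<Rightarrow> ('n \<Rightarrow> 'n \<Rightarrow> 'k) \<Rightarrow>
    ('n \<Rightarrow> 'n \<Rightarrow> 'n \<Rightarrow> 'n \<Rightarrow> 'k) \<Rightarrow> 'n \<Rightarrow> 'n \<Rightarrow> 'n \<Rightarrow> 'n \<Rightarrow> 'k" where
  "rotate_crossing cap cup X a b c d = (\<Sum>i\<in>UNIV. \<Sum>j\<in>UNIV. cap c i * X i a d j * cup j b)"

text \<open>
  Capping the upper right end of the turned crossing undoes the cup.  This is the switchback move at a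
  maximum, and the next lemma the one at a minimum.
\<close>

lemma rotate_crossing_cap:
  assumes "\<And>i j. (\<Sum>q\<in>UNIV. cup i q * cap q j) = mat 1 $ i $ j"
  shows "(\<Sum>b\<in>UNIV. rotate_crossing cap cup X a b c d * cap b g) = (\<Sum>i\<in>UNIV. cap c i * X i a d g)"
proof -
  have "(\<Sum>b\<in>UNIV. rotate_crossing cap cup X a b c d * cap b g) =
      (\<Sum>i\<in>UNIV. \<Sum>j\<in>UNIV. cap c i * X i a d j * (\<Sum>b\<in>UNIV. cup j b * cap b g))"
    unfolding rotate_crossing_def sum_distrib_left sum_distrib_right sum.cartesian_product
    by (rule sum.reindex_bij_witness[where i = "\<lambda>(i, j, b). (b, i, j)" and j = "\<lambda>(b, i, j). (i, j, b)"])
      (auto simp: mult_ac)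
  then show ?thesis by (simp add: assms sum_mat_1_right)
qed

lemma rotate_crossing_cup:
  assumes "\<And>i j. (\<Sum>q\<in>UNIV. cup i q * cap q j) = mat 1 $ i $ j"
  shows "(\<Sum>c\<in>UNIV. cup g c * rotate_crossing cap cup X a b c d) = (\<Sum>j\<in>UNIV. X g a d j * cup j b)"
proof -
  have "(\<Sum>c\<in>UNIV. cup g c * rotate_crossing cap cup X a b c d) =
      (\<Sum>i\<in>UNIV. (\<Sum>c\<in>UNIV. cup g c * cap c i) * (\<Sum>j\<in>UNIV. X i a d j * cup j b))"
    unfolding rotate_crossing_def sum_distrib_left sum_distrib_right sum.cartesian_product
    by (rule sum.reindex_bij_witness[where i = "\<lambda>(i, j, c). (c, i, j)" and j = "\<lambda>(c, i, j). (i, j, c)"])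
      (auto simp: mult_ac)
  then show ?thesis by (simp add: assms sum_mat_1_left)
qed

text \<open>
  Strand 1 is bent so that it enters at the right, beyond the strands 2 and 3.  Between its two crossings
  the cup of the one and the cap of the other cancel, and its outermost cap and cup are common to both
  sides.  The lower side for \<open>(1, 2, 3)\<close> thus becomes the upper side for \<open>(2, 3, 1)\<close>, and vice versa.
\<close>

lemma triangle_rotate:
  assumes cupcap: "\<And>i j. (\<Sum>q\<in>UNIV. cup i q * cap q j) = mat 1 $ i $ j"
    and ZAB: "triangle Z A B"
  shows "triangle (rotate_crossing cap cup A) (rotate_crossing cap cup B) Z"
  unfolding triangle_iff_entries
proof (intro allI)
  fix c1 c2 c3 a1 a2 a3
  let ?A = "rotate_crossing cap cup A" and ?B = "rotate_crossing cap cup B"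
  have "lower_triangle ?A ?B Z c1 c2 c3 a1 a2 a3 =
      (\<Sum>p\<in>UNIV. \<Sum>w\<in>UNIV. \<Sum>i\<in>UNIV. \<Sum>j\<in>UNIV.
        (\<Sum>q\<in>UNIV. ?A p q c1 c2 * cap q i) * (B i w c3 j * cup j a3 * Z a1 a2 p w))"
    unfolding lower_triangle_def rotate_crossing_def[of _ _ B] sum_distrib_left sum_distrib_right sum.cartesian_product
    by (rule sum.reindex_bij_witness[where i = "\<lambda>(p, w, i, j, q). (p, q, w, i, j)" and j = "\<lambda>(p, q, w, i, j). (p, w, i, j, q)"])
      (auto simp: mult_ac)
  also have "\<dots> = (\<Sum>i\<in>UNIV. \<Sum>j\<in>UNIV. cap c1 i * upper_triangle Z A B c2 c3 j i a1 a2 * cup j a3)"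
    unfolding rotate_crossing_cap[of cup cap, OF cupcap] upper_triangle_def sum_distrib_left sum_distrib_right sum.cartesian_product
    by (rule sum.reindex_bij_witness[where i = "\<lambda>(i, j, p, q, w). (w, q, p, j, i)" and j = "\<lambda>(w, q, p, j, i). (i, j, p, q, w)"])
      (auto simp: mult_ac)
  also have "\<dots> = (\<Sum>i\<in>UNIV. \<Sum>j\<in>UNIV. cap c1 i * lower_triangle Z A B c2 c3 j i a1 a2 * cup j a3)"
    using ZAB by (simp add: triangle_iff_entries)
  also have "\<dots> = (\<Sum>p\<in>UNIV. \<Sum>q\<in>UNIV. \<Sum>i\<in>UNIV. \<Sum>w\<in>UNIV.
      Z p q c2 c3 * (cap c1 i * B i a1 p w) * (\<Sum>j\<in>UNIV. A w a2 q j * cup j a3))"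
    unfolding lower_triangle_def sum_distrib_left sum_distrib_right sum.cartesian_product
    by (rule sum.reindex_bij_witness[where j = "\<lambda>(i, j, p, q, w). (p, q, i, w, j)" and i = "\<lambda>(p, q, i, w, j). (i, j, p, q, w)"])
      (auto simp: mult_ac)
  also have "\<dots> = upper_triangle ?A ?B Z c1 c2 c3 a1 a2 a3"
    unfolding rotate_crossing_cup[of cup cap, OF cupcap, symmetric] upper_triangle_def rotate_crossing_def[of _ _ B]
      sum_distrib_left sum_distrib_right sum.cartesian_product
    by (rule sum.reindex_bij_witness[where i = "\<lambda>(p, q, w, i, j). (p, q, i, j, w)" and j = "\<lambda>(p, q, i, j, w). (p, q, w, i, j)"])
      (auto simp: mult_ac)
  finally show "lower_triangle ?A ?B Z c1 c2 c3 a1 a2 a3 = upper_triangle ?A ?B Z c1 c2 c3 a1 a2 a3" .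
qed

section \<open>The crossings of the matrix model\<close>

lemma matrix_inv_mult:
  fixes M :: "'k::comm_ring_1^'n::finite^'n"
  assumes "invertible M"
  shows "M ** matrix_inv M = mat 1" "matrix_inv M ** M = mat 1"
  using someI_ex[OF assms[unfolded invertible_def]] unfolding matrix_inv_def by auto

text \<open>
  If \<open>R\<close> commutes with \<open>K\<close>, so does its inverse.
\<close>

lemma conj_fixed_inverse:
  fixes R S K K' :: "'k::comm_ring_1^'m::finite^'m"
  assumes RS: "R ** S = mat 1" and SR: "S ** R = mat 1"
    and KK': "K ** K' = mat 1" "K' ** K = mat 1" and R: "K ** R ** K' = R"
  shows "K ** S ** K' = S"
proof -
  have "R ** K = (K ** R ** K') ** K" by (simp only: R)
  also have "\<dots> = K ** R ** (K' ** K)" by (simp only: matrix_mul_assoc)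
  finally have KR: "R ** K = K ** R" by (simp add: KK')
  have "K ** S = (S ** R) ** (K ** S)" by (simp add: SR)
  also have "\<dots> = S ** (R ** K) ** S" by (simp only: matrix_mul_assoc)
  also have "\<dots> = (S ** K) ** (R ** S)" by (simp only: KR matrix_mul_assoc)
  finally have "K ** S ** K' = S ** (K ** K')" by (simp add: RS matrix_mul_assoc)
  then show ?thesis by (simp add: KK')
qed

text \<open>
  The relations of a balanced oriented quantum algebra, read off entry by entry in the full matrix
  algebra.  Only their images there survive: the tensor square of a subalgebra need not embed in the
  tensor square of the matrix algebra, but relations can be pushed forward.
\<close>

locale balanced_R_matrix =
  fixes P Q :: "(('k::comm_ring_1^'n::finite^'n) \<times> ('k^'n^'n)) list" and M :: "'k^'n^'n"
    and tau :: "'k^'n^'n \<Rightarrow> 'k^'n^'n" and e e' E E' :: "nat \<Rightarrow> 'k^'n^'n" 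
  defines "tau m \<equiv> M ** m ** matrix_inv M"
    and "e x \<equiv> fst (P ! x)" and "e' x \<equiv> snd (P ! x)"
    and "E x \<equiv> fst (Q ! x)" and "E' x \<equiv> snd (Q ! x)"
  assumes M: "invertible M"
    and rho_rho_inv: "(\<Sum>x<length P. \<Sum>y<length Q. (e x ** E y) $ i $ j * (e' x ** E' y) $ k $ l) =
      mat 1 $ i $ j * mat 1 $ k $ l"
    and rho_inv_rho: "(\<Sum>y<length Q. \<Sum>x<length P. (E y ** e x) $ i $ j * (E' y ** e' x) $ k $ l) =
      mat 1 $ i $ j * mat 1 $ k $ l"
    and rho_rho_inv_op: "(\<Sum>x<length P. \<Sum>y<length Q. (e x ** tau (E y)) $ i $ j * (E' y ** tau (e' x)) $ k $ l) =
      mat 1 $ i $ j * mat 1 $ k $ l"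
    and rho_inv_rho_op: "(\<Sum>y<length Q. \<Sum>x<length P. (tau (E y) ** e x) $ i $ j * (tau (e' x) ** E' y) $ k $ l) =
      mat 1 $ i $ j * mat 1 $ k $ l"
    and tau_rho: "(\<Sum>x<length P. tau (e x) $ i $ j * tau (e' x) $ k $ l) = (\<Sum>x<length P. e x $ i $ j * e' x $ k $ l)"
    and yang_baxter: "(\<Sum>x<length P. \<Sum>y<length P. \<Sum>z<length P.
        (e x ** e y) $ i $ j * (e' x ** e z) $ k $ l * (e' y ** e' z) $ g $ h) =
      (\<Sum>z<length P. \<Sum>y<length P. \<Sum>x<length P.
        (e y ** e x) $ i $ j * (e z ** e' x) $ k $ l * (e' z ** e' y) $ g $ h)"
begin

text \<open>
  \<open>(T \<otimes> T)\<rho>\<^sup>-\<^sup>1 = \<rho>\<^sup>-\<^sup>1\<close>: on Kronecker products \<open>T \<otimes> T\<close> is the conjugation by \<open>M \<otimes> M\<close>, and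
  inverses are unique.
\<close>

lemma tau_rho_inv:
  "(\<Sum>y<length Q. tau (E y) $ i $ j * tau (E' y) $ k $ l) = (\<Sum>y<length Q. E y $ i $ j * E' y $ k $ l)"
proof -
  define kron :: "'k^'n^'n \<Rightarrow> 'k^'n^'n \<Rightarrow> 'k^('n\<times>'n)^('n\<times>'n)"
    where "kron x y = (\<chi> p q. x $ fst p $ fst q * y $ snd p $ snd q)" for x y
  have kron_mult: "kron x y ** kron x' y' = kron (x ** x') (y ** y')" for x y x' y'
    unfolding kron_def matrix_matrix_mult_def vec_eq_iff
    by (auto simp: sum_product sum.cartesian_product mult_ac simp flip: UNIV_Times_UNIV intro!: sum.cong)
  have kron_1: "kron (mat 1) (mat 1) = mat 1"
    by (auto simp: kron_def mat_def vec_eq_iff)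
  have mult_sum_left: "A ** (\<Sum>x\<in>I. B x) = (\<Sum>x\<in>I. A ** B x)" 
    and mult_sum_right: "(\<Sum>x\<in>I. B x) ** A = (\<Sum>x\<in>I. B x ** A)" 
    for A :: "'k^('n\<times>'n)^('n\<times>'n)" and B and I :: "nat set"
    by (simp_all add: vec_eq_iff matrix_matrix_mult_def sum_distrib_left sum_distrib_right sum.swap[of _ I])
  let ?R = "\<Sum>x<length P. kron (e x) (e' x)" and ?S = "\<Sum>y<length Q. kron (E y) (E' y)"
  let ?K = "kron M M" and ?K' = "kron (matrix_inv M) (matrix_inv M)"
  have RS: "?R ** ?S = mat 1"
    unfolding mult_sum_left unfolding mult_sum_right kron_mult
    by (subst sum.swap) (simp add: vec_eq_iff kron_def rho_rho_inv kron_1[symmetric])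
  have SR: "?S ** ?R = mat 1"
    unfolding mult_sum_left unfolding mult_sum_right kron_mult
    by (subst sum.swap) (simp add: vec_eq_iff kron_def rho_inv_rho kron_1[symmetric])
  have KK: "?K ** ?K' = mat 1" "?K' ** ?K = mat 1"
    by (simp_all add: kron_mult matrix_inv_mult[OF M] kron_1)
  have conj: "?K ** (\<Sum>x\<in>I. kron (a x) (b x)) ** ?K' = (\<Sum>x\<in>I. kron (tau (a x)) (tau (b x)))" for a b and I :: "nat set"
    by (simp add: mult_sum_left mult_sum_right kron_mult tau_def)
  have "?K ** ?R ** ?K' = ?R"
    unfolding conj by (simp add: vec_eq_iff kron_def tau_rho)
  then have "?K ** ?S ** ?K' = ?S"
    by (rule conj_fixed_inverse[OF RS SR KK])
  then have "(?K ** ?S ** ?K') $ (i, k) $ (j, l) = ?S $ (i, k) $ (j, l)" by simp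
  then show ?thesis unfolding conj by (simp add: kron_def)
qed

abbreviation cap where "cap \<equiv> cap_entry M"
abbreviation cup where "cup \<equiv> cup_entry M"

definition crossing :: "bool \<Rightarrow> dir \<Rightarrow> dir \<Rightarrow> 'n \<Rightarrow> 'n \<Rightarrow> 'n \<Rightarrow> 'n \<Rightarrow> 'k" where
  "crossing ov s t = cross_entry M (if positive_crossing ov s t then R_up P else S_up Q) s t"

lemma R_up_sum: "R_up P a b c d = (\<Sum>x<length P. e x $ c $ b * e' x $ d $ a)"
  by (simp add: R_up_def sum_list_nth case_prod_beta e_def e'_def)

lemma S_up_sum: "S_up Q a b c d = (\<Sum>y<length Q. E y $ d $ a * E' y $ c $ b)"
  by (simp add: S_up_def sum_list_nth case_prod_beta E_def E'_def)

lemma tau_entry: "tau x $ b $ c = (\<Sum>i\<in>UNIV. \<Sum>j\<in>UNIV. M $ b $ j * x $ j $ i * matrix_inv M $ i $ c)"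
  by (simp add: tau_def matrix_matrix_mult_def sum_distrib_right)

text \<open>
  Each crossing is a sum of products of two entries, one per strand, with row and column in the order in
  which the oriented strand passes its two ends.  For antiparallel strands the cap and the
  cup of the definition combine to \<open>tau\<close> on one factor.
\<close>

lemma crossing_entries:
  "crossing True Up Up a b c d = (\<Sum>x<length P. e x $ c $ b * e' x $ d $ a)"
  "crossing False Up Up a b c d = (\<Sum>y<length Q. E y $ d $ a * E' y $ c $ b)"
  "crossing True Down Down a b c d = (\<Sum>x<length P. e x $ b $ c * e' x $ a $ d)"
  "crossing False Down Down a b c d = (\<Sum>y<length Q. E y $ a $ d * E' y $ b $ c)"
  "crossing False Down Up a b c d = (\<Sum>x<length P. e x $ d $ a * tau (e' x) $ b $ c)"
  "crossing True Down Up a b c d = (\<Sum>y<length Q. tau (E y) $ b $ c * E' y $ d $ a)"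
  "crossing False Up Down a b c d = (\<Sum>x<length P. e x $ a $ d * tau (e' x) $ c $ b)"
  "crossing True Up Down a b c d = (\<Sum>y<length Q. tau (E y) $ c $ b * E' y $ a $ d)"
proof -
  have swap: "(\<Sum>i\<in>UNIV. \<Sum>j\<in>UNIV. \<Sum>x<n. F i j x) = (\<Sum>x<n. \<Sum>i\<in>UNIV. \<Sum>j\<in>UNIV. F i j x)"
    "(\<Sum>i\<in>UNIV. \<Sum>j\<in>UNIV. \<Sum>x<n. F i j x) = (\<Sum>x<n. \<Sum>j\<in>UNIV. \<Sum>i\<in>UNIV. F i j x)"
    for F :: "'n \<Rightarrow> 'n \<Rightarrow> nat \<Rightarrow> 'k" and n
    unfolding sum.cartesian_product
    by (rule sum.reindex_bij_witness[where i = "\<lambda>(x, i, j). (i, j, x)" and j = "\<lambda>(i, j, x). (x, i, j)"]; auto)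
      (rule sum.reindex_bij_witness[where i = "\<lambda>(x, j, i). (i, j, x)" and j = "\<lambda>(i, j, x). (x, j, i)"]; auto)
  note defs = crossing_def positive_crossing_def turned_def R_up_sum S_up_sum tau_entry
  show "crossing True Up Up a b c d = (\<Sum>x<length P. e x $ c $ b * e' x $ d $ a)"
    "crossing False Up Up a b c d = (\<Sum>y<length Q. E y $ d $ a * E' y $ c $ b)"
    "crossing True Down Down a b c d = (\<Sum>x<length P. e x $ b $ c * e' x $ a $ d)"
    "crossing False Down Down a b c d = (\<Sum>y<length Q. E y $ a $ d * E' y $ b $ c)"
    by (simp_all add: defs)
  show "crossing False Down Up a b c d = (\<Sum>x<length P. e x $ d $ a * tau (e' x) $ b $ c)"
    "crossing True Down Up a b c d = (\<Sum>y<length Q. tau (E y) $ b $ c * E' y $ d $ a)"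
    by (simp_all add: defs sum_distrib_left sum_distrib_right swap(1) mult_ac)
  show "crossing False Up Down a b c d = (\<Sum>x<length P. e x $ a $ d * tau (e' x) $ c $ b)"
    "crossing True Up Down a b c d = (\<Sum>y<length Q. tau (E y) $ c $ b * E' y $ a $ d)"
    by (simp_all add: defs sum_distrib_left sum_distrib_right swap(2) mult_ac)
qed

lemma matrix_inv_entries:
  "(\<Sum>q\<in>UNIV. M $ i $ q * matrix_inv M $ q $ j) = mat 1 $ i $ j"
  "(\<Sum>q\<in>UNIV. matrix_inv M $ i $ q * M $ q $ j) = mat 1 $ i $ j"
  using matrix_inv_mult[OF M] by (simp_all add: matrix_matrix_mult_def vec_eq_iff)

lemma mat_1_sym: "(mat 1 :: 'k^'n^'n) $ i $ j = mat 1 $ j $ i"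
  by (simp add: mat_def)

lemma cup_cap: "(\<Sum>q\<in>UNIV. cup (opp s) i q * cap s q j) = mat 1 $ i $ j"
  using matrix_inv_entries(2)[of i j] matrix_inv_entries(2)[of j i] mat_1_sym[of i j]
  by (cases s) (simp_all add: mult.commute[of "M $ _ $ _"])

lemma cap_cup: "(\<Sum>q\<in>UNIV. cap s i q * cup (opp s) q j) = mat 1 $ i $ j"
  using matrix_inv_entries(1)[of i j] matrix_inv_entries(1)[of j i] mat_1_sym[of i j]
  by (cases s) (simp_all add: mult.commute[of "matrix_inv M $ _ $ _"])

text \<open>
  Along each strand the two crossings contribute a matrix product, in the order of its orientation.
  Two upward strands give \<open>\<rho>\<rho>\<^sup>-\<^sup>1\<close> or its reverse.  For antiparallel strands one of the orders is
  reversed, which is the multiplication of \<open>A \<otimes> A\<^sup>o\<^sup>p\<close>.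
\<close>

lemma crossing_inverse: "inverse_crossings (crossing ov s t) (crossing (\<not> ov) t s)"
  unfolding inverse_crossings_def
proof (intro allI)
  fix a b c d
  let ?S = "\<Sum>p\<in>UNIV. \<Sum>q\<in>UNIV. crossing ov s t p q c d * crossing (\<not> ov) t s a b p q"
  note expand = crossing_entries matrix_matrix_mult_def vec_lambda_beta sum_product sum.cartesian_product not_True_eq_False not_False_eq_True
  consider "ov" "s = Up" "t = Up" | "\<not> ov" "s = Up" "t = Up" | "ov" "s = Down" "t = Down" | "\<not> ov" "s = Down" "t = Down"
    | "ov" "s = Down" "t = Up" | "\<not> ov" "s = Down" "t = Up" | "ov" "s = Up" "t = Down" | "\<not> ov" "s = Up" "t = Down"
    by (cases s; cases t; cases ov) auto
  then show "?S = mat 1 $ c $ a * mat 1 $ d $ b"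
  proof cases
    case 1
    then have "?S = (\<Sum>x<length P. \<Sum>y<length Q. (e x ** E y) $ c $ a * (e' x ** E' y) $ d $ b)"
      by (simp only: expand)
        (rule sum.reindex_bij_witness[where i = "\<lambda>(x, y, k, l). (l, k, x, y)" and j = "\<lambda>(l, k, x, y). (x, y, k, l)"]; auto simp: mult_ac)
    then show ?thesis unfolding rho_rho_inv by simp
  next
    case 2
    then have "?S = (\<Sum>y<length Q. \<Sum>x<length P. (E y ** e x) $ d $ b * (E' y ** e' x) $ c $ a)"
      by (simp only: expand)
        (rule sum.reindex_bij_witness[where i = "\<lambda>(x, y, k, l). (k, l, x, y)" and j = "\<lambda>(k, l, x, y). (x, y, k, l)"]; auto simp: mult_ac)
    then show ?thesis unfolding rho_inv_rho by (simp add: mult.commute)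
  next
    case 3
    then have "?S = (\<Sum>y<length Q. \<Sum>x<length P. (E y ** e x) $ a $ c * (E' y ** e' x) $ b $ d)"
      by (simp only: expand)
        (rule sum.reindex_bij_witness[where i = "\<lambda>(y, x, k, l). (l, k, x, y)" and j = "\<lambda>(l, k, x, y). (y, x, k, l)"]; auto simp: mult_ac)
    then show ?thesis unfolding rho_inv_rho by (simp add: mat_1_sym[of c] mat_1_sym[of d])
  next
    case 4
    then have "?S = (\<Sum>x<length P. \<Sum>y<length Q. (e x ** E y) $ b $ d * (e' x ** E' y) $ a $ c)"
      by (simp only: expand)
        (rule sum.reindex_bij_witness[where i = "\<lambda>(y, x, k, l). (k, l, x, y)" and j = "\<lambda>(k, l, x, y). (y, x, k, l)"]; auto simp: mult_ac)
    then show ?thesis unfolding rho_rho_inv by (simp add: mat_1_sym[of c] mat_1_sym[of d] mult.commute)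
  next
    case 5
    then have "?S = (\<Sum>x<length P. \<Sum>y<length Q. (e x ** tau (E y)) $ a $ c * (E' y ** tau (e' x)) $ d $ b)"
      by (simp only: expand)
        (rule sum.reindex_bij_witness[where i = "\<lambda>(y, x, k, l). (l, k, x, y)" and j = "\<lambda>(l, k, x, y). (y, x, k, l)"]; auto simp: mult_ac)
    then show ?thesis unfolding rho_rho_inv_op by (simp add: mat_1_sym[of c])
  next
    case 6
    then have "?S = (\<Sum>x<length P. \<Sum>y<length Q. (e x ** tau (E y)) $ d $ b * (E' y ** tau (e' x)) $ a $ c)"
      by (simp only: expand)
        (rule sum.reindex_bij_witness[where i = "\<lambda>(x, y, k, l). (k, l, x, y)" and j = "\<lambda>(k, l, x, y). (x, y, k, l)"]; auto simp: mult_ac)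
    then show ?thesis unfolding rho_rho_inv_op by (simp add: mat_1_sym[of c] mult.commute)
  next
    case 7
    then have "?S = (\<Sum>y<length Q. \<Sum>x<length P. (tau (E y) ** e x) $ c $ a * (tau (e' x) ** E' y) $ b $ d)"
      by (simp only: expand)
        (rule sum.reindex_bij_witness[where i = "\<lambda>(x, y, k, l). (l, k, x, y)" and j = "\<lambda>(l, k, x, y). (x, y, k, l)"]; auto simp: mult_ac)
    then show ?thesis unfolding rho_inv_rho_op by (simp add: mat_1_sym[of d])
  next
    case 8
    then have "?S = (\<Sum>y<length Q. \<Sum>x<length P. (tau (E y) ** e x) $ b $ d * (tau (e' x) ** E' y) $ c $ a)"
      by (simp only: expand)
        (rule sum.reindex_bij_witness[where i = "\<lambda>(y, x, k, l). (k, l, x, y)" and j = "\<lambda>(k, l, x, y). (y, x, k, l)"]; auto simp: mult_ac)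
    then show ?thesis unfolding rho_inv_rho_op by (simp add: mat_1_sym[of d] mult.commute)
  qed
qed

text \<open>
  Over and under are exchanged in the flag, since it refers to the strand from the lower left, and a
  quarter turn makes this the other strand.
\<close>

lemma crossing_rotate:
  "crossing ov s t = rotate_crossing (cap s) (cup (opp s)) (crossing (\<not> ov) t (opp s))"
proof (intro ext)
  fix a b c d
  have conj: "(\<Sum>i\<in>UNIV. \<Sum>j\<in>UNIV. M $ b $ i * (\<Sum>x\<in>I. A x $ i $ j * h x) * matrix_inv M $ j $ c) =
      (\<Sum>x\<in>I. tau (A x) $ b $ c * h x)" for A h b c and I :: "nat set"
    unfolding tau_entry sum_distrib_left sum_distrib_right sum.cartesian_product
    by (rule sum.reindex_bij_witness[where i = "\<lambda>(x, j, i). (i, j, x)" and j = "\<lambda>(i, j, x). (x, j, i)"]; auto simp: mult_ac)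
  have conj': "(\<Sum>i\<in>UNIV. \<Sum>j\<in>UNIV. matrix_inv M $ i $ c * (\<Sum>x\<in>I. A x $ j $ i * h x) * M $ b $ j) =
      (\<Sum>x\<in>I. tau (A x) $ b $ c * h x)" for A h b c and I :: "nat set"
    unfolding conj[symmetric] by (subst sum.swap) (simp add: mult_ac)
  \<comment> \<open>For parallel strands the turned crossing already carries a \<open>tau\<close> on one factor, and the cap and cup put one on the other.\<close>
  consider "s \<noteq> t" | "s = t" "s = Up" "ov" | "s = t" "s = Up" "\<not> ov" | "s = t" "s = Down" "ov" | "s = t" "s = Down" "\<not> ov"
    by (cases s; cases ov) auto
  then show "crossing ov s t a b c d = rotate_crossing (cap s) (cup (opp s)) (crossing (\<not> ov) t (opp s)) a b c d"
  proof cases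
    case 1
    then show ?thesis
      by (cases s; cases t) (simp_all add: crossing_def rotate_crossing_def positive_crossing_def)
  next
    case 2
    then show ?thesis
      by (simp add: rotate_crossing_def crossing_entries conj tau_rho)
  next
    case 3
    then show ?thesis
      by (simp add: rotate_crossing_def crossing_entries mult.commute[of "tau (E _) $ _ $ _"] conj)
        (simp add: mult.commute[of "tau (E' _) $ _ $ _"] tau_rho_inv)
  next
    case 4
    then show ?thesis
      by (simp add: rotate_crossing_def crossing_entries conj' tau_rho)
  next
    case 5
    then show ?thesis
      by (simp add: rotate_crossing_def crossing_entries mult.commute[of "tau (E _) $ _ $ _"] conj')
        (simp add: mult.commute[of "tau (E' _) $ _ $ _"] tau_rho_inv)
  qed
qed

text \<open>
  Strand by strand, the lower side is \<open>\<rho>\<^sub>1\<^sub>2\<rho>\<^sub>1\<^sub>3\<rho>\<^sub>2\<^sub>3\<close> and the upper side \<open>\<rho>\<^sub>2\<^sub>3\<rho>\<^sub>1\<^sub>3\<rho>\<^sub>1\<^sub>2\<close>.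
\<close>

lemma crossing_triangle_descending:
  "triangle (crossing True Up Up) (crossing True Up Up) (crossing True Up Up)"
  unfolding triangle_iff_entries
proof (intro allI)
  fix c1 c2 c3 a1 a2 a3
  let ?X = "crossing True Up Up"
  note expand = lower_triangle_def upper_triangle_def crossing_entries matrix_matrix_mult_def vec_lambda_beta sum_product3 sum.cartesian_product
  have "lower_triangle ?X ?X ?X c1 c2 c3 a1 a2 a3 = (\<Sum>x<length P. \<Sum>y<length P. \<Sum>z<length P.
        (e x ** e y) $ c1 $ a3 * (e' x ** e z) $ c2 $ a2 * (e' y ** e' z) $ c3 $ a1)"
    by (simp only: expand)
      (rule sum.reindex_bij_witness[where i = "\<lambda>(x, y, z, q, p, w). (p, q, w, x, y, z)" and j = "\<lambda>(p, q, w, x, y, z). (x, y, z, q, p, w)"]; auto simp: mult_ac)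
  also have "\<dots> = (\<Sum>z<length P. \<Sum>y<length P. \<Sum>x<length P.
        (e y ** e x) $ c1 $ a3 * (e z ** e' x) $ c2 $ a2 * (e' z ** e' y) $ c3 $ a1)"
    by (rule yang_baxter)
  also have "\<dots> = upper_triangle ?X ?X ?X c1 c2 c3 a1 a2 a3"
    by (simp only: expand)
      (rule sum.reindex_bij_witness[where j = "\<lambda>(z, y, x, w, q, p). (p, q, w, z, y, x)" and i = "\<lambda>(p, q, w, z, y, x). (z, y, x, w, q, p)"]; auto simp: mult_ac)
  finally show "lower_triangle ?X ?X ?X c1 c2 c3 a1 a2 a3 = upper_triangle ?X ?X ?X c1 c2 c3 a1 a2 a3" .
qed

lemma crossing_inverse': "inverse_crossings (crossing (\<not> ov) t s) (crossing ov s t)"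
  using crossing_inverse[of "\<not> ov" t s] by simp

lemma triangle_flip12:
  "triangle (crossing x s t) (crossing y s r) (crossing z t r) \<Longrightarrow>
   triangle (crossing (\<not> x) t s) (crossing z t r) (crossing y s r)"
  by (rule triangle_flip_first[OF _ crossing_inverse' crossing_inverse])

lemma triangle_flip23:
  "triangle (crossing x s t) (crossing y s r) (crossing z t r) \<Longrightarrow>
   triangle (crossing y s r) (crossing x s t) (crossing (\<not> z) r t)"
  by (rule triangle_flip_last[OF _ crossing_inverse' crossing_inverse])

text \<open>
  The two crossings of the bent strand are turned by a quarter; the third crossing stays as it is.
\<close>

lemma crossing_triangle_rotate:
  assumes "triangle (crossing z t r) (crossing (\<not> x) t (opp s)) (crossing (\<not> y) r (opp s))"
  shows "triangle (crossing x s t) (crossing y s r) (crossing z t r)"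
  unfolding crossing_rotate[of x s t] crossing_rotate[of y s r]
  by (rule triangle_rotate[OF cup_cap assms])

text \<open>
  The six admissible configurations are the orders of the heights of three strands.  Neighboring flips
  connect them all to the descending one.
\<close>

lemma crossing_triangle_upward:
  assumes "x = z \<longrightarrow> y = x"
  shows "triangle (crossing x Up Up) (crossing y Up Up) (crossing z Up Up)"
proof -
  \<comment> \<open>The letters are the flags \<open>x\<close>, \<open>y\<close>, \<open>z\<close>.\<close>
  note TTT = crossing_triangle_descending
  note FTT = triangle_flip12[OF TTT, unfolded not_True_eq_False]
    and TTF = triangle_flip23[OF TTT, unfolded not_True_eq_False]
  note TFF = triangle_flip23[OF FTT, unfolded not_True_eq_False]
    and FFT = triangle_flip12[OF TTF, unfolded not_True_eq_False]
  note FFF = triangle_flip12[OF TFF, unfolded not_True_eq_False]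
  show ?thesis
    using assms TTT FTT TTF TFF FFT FFF by (cases x; cases y; cases z) simp_all
qed

lemma crossing_triangle:
  assumes "x = z \<longrightarrow> y = x"
  shows "triangle (crossing x s t) (crossing y s r) (crossing z t r)"
proof -
  let ?ok = "\<lambda>x y z. x = z \<longrightarrow> y = (x :: bool)"
  \<comment> \<open>Five successive rotations lead from upward strands through all braid-like directions; the condition on the heights is invariant under them.\<close>
  have UUU: "?ok x y z \<Longrightarrow> triangle (crossing x Up Up) (crossing y Up Up) (crossing z Up Up)" for x y z
    by (rule crossing_triangle_upward)
  have DUU: "?ok x y z \<Longrightarrow> triangle (crossing x Down Up) (crossing y Down Up) (crossing z Up Up)" for x y z
    by (rule crossing_triangle_rotate) (simp, rule UUU, auto)
  have DDU: "?ok x y z \<Longrightarrow> triangle (crossing x Down Down) (crossing y Down Up) (crossing z Down Up)" for x y z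
    by (rule crossing_triangle_rotate) (simp, rule DUU, auto)
  have DDD: "?ok x y z \<Longrightarrow> triangle (crossing x Down Down) (crossing y Down Down) (crossing z Down Down)" for x y z
    by (rule crossing_triangle_rotate) (simp, rule DDU, auto)
  have UDD: "?ok x y z \<Longrightarrow> triangle (crossing x Up Down) (crossing y Up Down) (crossing z Down Down)" for x y z
    by (rule crossing_triangle_rotate) (simp, rule DDD, auto)
  have UUD: "?ok x y z \<Longrightarrow> triangle (crossing x Up Up) (crossing y Up Down) (crossing z Up Down)" for x y z
    by (rule crossing_triangle_rotate) (simp, rule UDD, auto)
  \<comment> \<open>A cyclically oriented triangle has no braid-like rotation, but exchanging its first two strands makes it braid-like.\<close>
  have UDU: "triangle (crossing x Up Down) (crossing y Up Up) (crossing z Down Up)" if "?ok x y z" for x y z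
  proof -
    have "?ok (\<not> x) z y" using that by blast
    from triangle_flip12[OF DUU[OF this]] show ?thesis by simp
  qed
  have DUD: "triangle (crossing x Down Up) (crossing y Down Down) (crossing z Up Down)" if "?ok x y z" for x y z
  proof -
    have "?ok (\<not> x) z y" using that by blast
    from triangle_flip12[OF UDD[OF this]] show ?thesis by simp
  qed
  show ?thesis
    using assms by (cases s; cases t; cases r) (simp_all only: UUU DUU DDU DDD UDD UUD UDU DUD)
qed

end

text \<open>
  The carrier of the subalgebra disappears here, because products and entries do not depend on it.
\<close>

lemma balanced_R_matrixI:
  fixes M :: "'k::comm_ring_1^'n::finite^'n"
  assumes "balanced_oriented_quantum_algebra (matrix_algebra\<lparr>carrier := S\<rparr>) P Q tau"
    and tau: "\<And>x. tau x = M ** x ** matrix_inv M" and "invertible M"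
  shows "balanced_R_matrix P Q M"
proof -
  let ?B = "matrix_algebra\<lparr>carrier := S\<rparr>"
  have one: "\<one>\<^bsub>?B\<^esub> = mat 1" by (simp add: matrix_algebra_def)
  note hyp = assms(1)[unfolded balanced_oriented_quantum_algebra_def]
  have "tensor2_eq ?B (tensor2_mult ?B P Q) [(\<one>\<^bsub>?B\<^esub>, \<one>\<^bsub>?B\<^esub>)]"
    and "tensor2_eq ?B (tensor2_mult ?B Q P) [(\<one>\<^bsub>?B\<^esub>, \<one>\<^bsub>?B\<^esub>)]"
    and "tensor2_eq ?B (map (map_prod tau tau) P) P"
    and "tensor2_eq ?B (tensor2_mult_op ?B (map (map_prod id tau) P) (map (map_prod tau id) Q)) [(\<one>\<^bsub>?B\<^esub>, \<one>\<^bsub>?B\<^esub>)]"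
    and "tensor2_eq ?B (tensor2_mult_op ?B (map (map_prod tau id) Q) (map (map_prod id tau) P)) [(\<one>\<^bsub>?B\<^esub>, \<one>\<^bsub>?B\<^esub>)]"
    using hyp by simp_all
  note eqs2 = this[THEN tensor2_eq_entries, unfolded one tensor2_mult_entries tensor2_mult_op_entries]
  have "tensor3_eq ?B (tensor3_mult ?B (tensor3_mult ?B (leg12 ?B P) (leg13 ?B P)) (leg23 ?B P))
       (tensor3_mult ?B (tensor3_mult ?B (leg23 ?B P) (leg13 ?B P)) (leg12 ?B P))"
    using hyp by simp
  note eq3 = this[THEN tensor3_eq_entries, unfolded tensor3_mult_entries]
  show ?thesis
  proof unfold_locales
    show "invertible M" by fact
  next
    fix i j k l g h
    show "(\<Sum>x<length P. \<Sum>y<length P. \<Sum>z<length P.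
        (fst (P ! x) ** fst (P ! y)) $ i $ j * (snd (P ! x) ** fst (P ! z)) $ k $ l * (snd (P ! y) ** snd (P ! z)) $ g $ h) =
      (\<Sum>z<length P. \<Sum>y<length P. \<Sum>x<length P.
        (fst (P ! y) ** fst (P ! x)) $ i $ j * (fst (P ! z) ** snd (P ! x)) $ k $ l * (snd (P ! z) ** snd (P ! y)) $ g $ h)"
      using eq3[of i j k l g h]
      by (simp add: leg12_def leg13_def leg23_def one o_def case_prod_beta sum_list_nth)
  qed (use eqs2 in \<open>simp_all add: sum_list_nth case_prod_beta tau\<close>)
qed

section \<open>Invariance under the local moves\<close>

lemma opp_opp [simp]: "opp (opp s) = s"
  by (cases s) simp_all

lemma sum_lists_two:
  "(\<Sum>z | length z = Suc (Suc 0). g z) = (\<Sum>a\<in>UNIV. \<Sum>b\<in>UNIV. g [a, b :: 'n::finite])"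
  unfolding sum.cartesian_product
  by (rule sum.reindex_bij_witness[where i = "\<lambda>(a, b). [a, b]" and j = "\<lambda>z. (z ! 0, z ! 1)"])
    (auto simp: length_Suc_conv)

lemma evaluate_heights:
  assumes "length x = length (bot p) + length w + length (bot q)"
  shows "evaluate P Q M [([], p, w @ bot q), (top p @ w, q, [])] f x =
    evaluate P Q M [(bot p @ w, q, []), ([], p, w @ top q)] f x"
proof -
  define x1 x2 x3 where "x1 = take (length (bot p)) x" and "x2 = take (length w) (drop (length (bot p)) x)"
    and "x3 = drop (length (bot p) + length w) x"
  have x: "x = x1 @ x2 @ x3"
    unfolding x1_def x2_def x3_def by (metis add.commute append_take_drop_id drop_drop)
  have l: "length x1 = length (bot p)" "length x2 = length w" "length x3 = length (bot q)"
    using assms unfolding x1_def x2_def x3_def by simp_all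
  have "evaluate P Q M [([], p, w @ bot q), (top p @ w, q, [])] f x =
      (\<Sum>y | length y = length (top p). \<Sum>z | length z = length (top q).
        piece_entry P Q M p x1 y * (piece_entry P Q M q x3 z * f (y @ x2 @ z)))"
    by (simp add: x l sum_distrib_left)
  also have "\<dots> = (\<Sum>z | length z = length (top q). \<Sum>y | length y = length (top p).
        piece_entry P Q M q x3 z * (piece_entry P Q M p x1 y * f (y @ x2 @ z)))"
    by (subst sum.swap) (simp add: mult_ac)
  also have "\<dots> = evaluate P Q M [(bot p @ w, q, []), ([], p, w @ top q)] f x"
    by (simp add: x l sum_distrib_left)
  finally show ?thesis .
qed

lemma (in balanced_R_matrix) evaluate_local_move:
  assumes "local_move L L'" and x: "length x = length (source (hd L))"
  shows "evaluate P Q M L f x = evaluate P Q M L' f x"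
  using assms(1)
proof cases
  case (heights p w q)
  then show ?thesis using x evaluate_heights[of x p w q P Q M f] by simp
next
  case (cancel_left s)
  then obtain c where c: "x = [c]" using x by (auto simp: length_Suc_conv)
  have "evaluate P Q M L f x = (\<Sum>a\<in>UNIV. \<Sum>b\<in>UNIV. cup (opp s) a b * (cap s c a * f [b]))"
    by (simp add: cancel_left c sum_lists_two)
  also have "\<dots> = (\<Sum>b\<in>UNIV. (\<Sum>a\<in>UNIV. cap s c a * cup (opp s) a b) * f [b])"
    by (subst sum.swap) (simp add: sum_distrib_left sum_distrib_right mult_ac)
  finally show ?thesis by (simp add: cancel_left c cap_cup sum_mat_1_left)
next
  case (cancel_right s)
  then obtain c where c: "x = [c]" using x by (auto simp: length_Suc_conv)
  have "evaluate P Q M L f x = (\<Sum>a\<in>UNIV. \<Sum>b\<in>UNIV. cup s a b * (cap (opp s) b c * f [a]))"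
    by (simp add: cancel_right c sum_lists_two)
  also have "\<dots> = (\<Sum>a\<in>UNIV. f [a] * (\<Sum>b\<in>UNIV. cup (opp (opp s)) a b * cap (opp s) b c))"
    by (simp add: sum_distrib_left mult_ac)
  also have "\<dots> = f [c]" by (simp only: cup_cap sum_mat_1_right)
  finally show ?thesis by (simp add: cancel_right c)
next
  case (switchback_max ov s t)
  then obtain c d g where c: "x = [c, d, g]" using x by (auto simp: length_Suc_conv)
  have "evaluate P Q M L f x =
      (\<Sum>a\<in>UNIV. \<Sum>b\<in>UNIV. crossing ov s t a b c d * (cap s b g * f [a]))"
    by (simp add: switchback_max c sum_lists_two crossing_def)
  also have "\<dots> = (\<Sum>a\<in>UNIV. (\<Sum>b\<in>UNIV. crossing ov s t a b c d * cap s b g) * f [a])"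
    by (simp add: sum_distrib_right mult.assoc)
  also have "\<dots> = (\<Sum>a\<in>UNIV. (\<Sum>i\<in>UNIV. cap s c i * crossing (\<not> ov) t (opp s) i a d g) * f [a])"
    unfolding crossing_rotate[of ov s t] rotate_crossing_cap[of "cup (opp s)" "cap s", OF cup_cap] ..
  also have "\<dots> = (\<Sum>i\<in>UNIV. \<Sum>a\<in>UNIV. crossing (\<not> ov) t (opp s) i a d g * (cap s c i * f [a]))"
    unfolding sum_distrib_right by (subst sum.swap) (simp add: mult_ac)
  also have "\<dots> = evaluate P Q M L' f x"
    by (simp add: switchback_max c sum_lists_two crossing_def)
  finally show ?thesis .
next
  case (switchback_min t s ov)
  then obtain d where d: "x = [d]" using x by (auto simp: length_Suc_conv)
  have rot: "(\<Sum>j\<in>UNIV. cup s a1 j * crossing (\<not> ov) (opp s) t a2 a3 j d) =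
      (\<Sum>i\<in>UNIV. crossing ov t s a1 a2 d i * cup s i a3)" for a1 a2 a3
    using rotate_crossing_cup[of "cup s" "cap (opp s)", OF cup_cap[of "opp s", simplified]]
    unfolding crossing_rotate[of "\<not> ov" "opp s" t] by simp
  have "evaluate P Q M L f x = (\<Sum>i\<in>UNIV. \<Sum>a3\<in>UNIV. cup s i a3 *
      (\<Sum>a1\<in>UNIV. \<Sum>a2\<in>UNIV. crossing ov t s a1 a2 d i * f [a1, a2, a3]))"
    by (simp add: switchback_min d sum_lists_two crossing_def)
  also have "\<dots> = (\<Sum>a1\<in>UNIV. \<Sum>a2\<in>UNIV. \<Sum>a3\<in>UNIV.
      (\<Sum>i\<in>UNIV. crossing ov t s a1 a2 d i * cup s i a3) * f [a1, a2, a3])"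
    unfolding sum_distrib_left sum_distrib_right sum.cartesian_product
    by (rule sum.reindex_bij_witness[where i = "\<lambda>(a1, a2, a3, i). (i, a3, a1, a2)"
          and j = "\<lambda>(i, a3, a1, a2). (a1, a2, a3, i)"]) (auto simp: mult_ac)
  also have "\<dots> = (\<Sum>a1\<in>UNIV. \<Sum>j\<in>UNIV. cup s a1 j *
      (\<Sum>a2\<in>UNIV. \<Sum>a3\<in>UNIV. crossing (\<not> ov) (opp s) t a2 a3 j d * f [a1, a2, a3]))"
    unfolding rot[symmetric] sum_distrib_left sum_distrib_right sum.cartesian_product
    by (rule sum.reindex_bij_witness[where j = "\<lambda>(a1, a2, a3, i). (a1, i, a2, a3)"
          and i = "\<lambda>(a1, i, a2, a3). (a1, a2, a3, i)"]) (auto simp: mult_ac)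
  also have "\<dots> = evaluate P Q M L' f x"
    by (simp add: switchback_min d sum_lists_two crossing_def)
  finally show ?thesis .
next
  case (R2 ov s t)
  then obtain c d where c: "x = [c, d]" using x by (auto simp: length_Suc_conv)
  have "evaluate P Q M L f x = (\<Sum>p\<in>UNIV. \<Sum>q\<in>UNIV. crossing ov s t p q c d *
      (\<Sum>a\<in>UNIV. \<Sum>b\<in>UNIV. crossing (\<not> ov) t s a b p q * f [a, b]))"
    by (simp add: R2 c sum_lists_two crossing_def)
  then show ?thesis
    using inverse_crossings_apply[OF crossing_inverse, of _ _ _ c d "\<lambda>a b. f [a, b]"]
    by (simp add: R2 c)
next
  case (R3 u w v s t r)
  then obtain c1 c2 c3 where c: "x = [c1, c2, c3]" using x by (auto simp: length_Suc_conv)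
  let ?X = "crossing u s t" and ?Y = "crossing v s r" and ?Z = "crossing w t r"
    and ?f = "\<lambda>a b c. f [a, b, c]"
  have "evaluate P Q M L f x = op12 ?X (op23 ?Y (op12 ?Z ?f)) c1 c2 c3"
    by (simp add: R3 c sum_lists_two op12_def op23_def crossing_def)
  also have "\<dots> = op23 ?Z (op12 ?Y (op23 ?X ?f)) c1 c2 c3"
    using fun_cong[OF crossing_triangle[OF R3(3), unfolded triangle_def], of s t r ?f] by simp
  also have "\<dots> = evaluate P Q M L' f x"
    by (simp add: R3 c sum_lists_two op12_def op23_def crossing_def)
  finally show ?thesis .
qed

theorem mainTheorem2:
  fixes A :: "('k::comm_ring_1, 'a, 'm) module_scheme"
    and rho rho_inv :: "('a \<times> 'a) list"
    and T :: "'a \<Rightarrow> 'a"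
    and Rep :: "'a \<Rightarrow> 'k^'n::finite^'n"
    and M :: "'k^'n^'n"
    and tau :: "'k^'n^'n \<Rightarrow> 'k^'n^'n"
    and K K' :: "layer list"
  assumes "balanced_oriented_quantum_algebra A rho rho_inv T"
    and "algebra_hom A matrix_algebra Rep"
    and "invertible M"
    and "\<And>x. tau x = M ** x ** matrix_inv M"
    and "balanced_oriented_quantum_algebra
           (matrix_algebra\<lparr>carrier := Rep ` carrier A\<rparr>)
           (map (map_prod Rep Rep) rho) (map (map_prod Rep Rep) rho_inv) tau"
    and "\<And>a. a \<in> carrier A \<Longrightarrow> Rep (T a) = tau (Rep a)"
    and "link_diagram K" and "link_diagram K'"
    and "regularly_isotopic K K'"
  shows "state_sum (map (map_prod Rep Rep) rho) (map (map_prod Rep Rep) rho_inv) M K =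
         state_sum (map (map_prod Rep Rep) rho) (map (map_prod Rep Rep) rho_inv) M K'"
  using assms(9)
proof (rule state_sum_regularly_isotopic)
  let ?P = "map (map_prod Rep Rep) rho" and ?Q = "map (map_prod Rep Rep) rho_inv"
  have "balanced_R_matrix ?P ?Q M"
    by (rule balanced_R_matrixI[OF assms(5)]) (use assms(3,4) in auto)
  then show "evaluate ?P ?Q M L f x = evaluate ?P ?Q M L' f x"
    if "local_move L L'" and "length x = length (source (hd L))" for L L' f x
    using that by (rule balanced_R_matrix.evaluate_local_move)
qed

end
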